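(* Let $G$ be a minimum imperfect graph. Then $G$ admits no balanced skew partition, and no skew partition of $G$ is loose.
   Context: Graphs are finite and simple. Berge: every hole (induced cycle of length $\ge4$) and antihole (induced subgraph whose complement is a hole) has even length. Perfect: every induced subgraph has chromatic number equal to its maximum clique size. A minimum imperfect graph is a Berge graph that is not perfect and has the minimum number of vertices among all Berge graphs that are not perfect. Paths/antipaths are induced subgraphs that are paths / whose complements are paths; lengths count edges (of the complement for antipaths). $X$ connected: $G|X$ connected; anticonnected: $\overline G|X$ connected; components/anticomponents are maximal connected/anticonnected subsets. A skew partition is a partition $(A,B)$ of $V(G)$ with $A$ not connected and $B$ not anticonnected; it is balanced if there is no odd path between nonadjacent vertices of $B$ with interior in $A$ and no odd antipath between adjacent vertices of $A$ with interior in $B$; it is loose if some vertex of $B$ has no neighbour in some component of $A$, or some vertex of $A$ is adjacent to all vertices of some anticomponent of $B$. *)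

theory Defs
  imports Main
begin

text \<open>A finite simple graph: finite vertex set V and a symmetric irreflexive
  adjacency relation E whose edges lie inside V.\<close>
definition graph :: "'a set \<Rightarrow> ('a \<Rightarrow> 'a \<Rightarrow> bool) \<Rightarrow> bool" where
  "graph V E \<longleftrightarrow> finite V \<and> (\<forall>x y. E x y \<longrightarrow> x \<in> V \<and> y \<in> V \<and> x \<noteq> y \<and> E y x)"

text \<open>Adjacency in the complement graph.\<close>
definition co :: "('a \<Rightarrow> 'a \<Rightarrow> bool) \<Rightarrow> 'a \<Rightarrow> 'a \<Rightarrow> bool" where
  "co E x y \<longleftrightarrow> x \<noteq> y \<and> \<not> E x y"

text \<open>Induced path given by its vertex sequence; its length is length vs - 1.\<close>
definition ind_path :: "'a set \<Rightarrow> ('a \<Rightarrow> 'a \<Rightarrow> bool) \<Rightarrow> 'a list \<Rightarrow> bool" where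
  "ind_path V E vs \<longleftrightarrow> vs \<noteq> [] \<and> distinct vs \<and> set vs \<subseteq> V \<and>
     (\<forall>i<length vs. \<forall>j<length vs. E (vs!i) (vs!j) \<longleftrightarrow> (i = Suc j \<or> j = Suc i))"

text \<open>Induced cycle (of length = length vs, at least 4).\<close>
definition hole :: "'a set \<Rightarrow> ('a \<Rightarrow> 'a \<Rightarrow> bool) \<Rightarrow> 'a list \<Rightarrow> bool" where
  "hole V E vs \<longleftrightarrow> length vs \<ge> 4 \<and> distinct vs \<and> set vs \<subseteq> V \<and>
     (\<forall>i<length vs. \<forall>j<length vs. E (vs!i) (vs!j) \<longleftrightarrow>
        (j = Suc i mod length vs \<or> i = Suc j mod length vs))"

definition antihole :: "'a set \<Rightarrow> ('a \<Rightarrow> 'a \<Rightarrow> bool) \<Rightarrow> 'a list \<Rightarrow> bool" where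
  "antihole V E vs \<longleftrightarrow> hole V (co E) vs"

definition berge :: "'a set \<Rightarrow> ('a \<Rightarrow> 'a \<Rightarrow> bool) \<Rightarrow> bool" where
  "berge V E \<longleftrightarrow> (\<forall>vs. hole V E vs \<longrightarrow> even (length vs)) \<and>
                  (\<forall>vs. antihole V E vs \<longrightarrow> even (length vs))"

definition clique :: "('a \<Rightarrow> 'a \<Rightarrow> bool) \<Rightarrow> 'a set \<Rightarrow> bool" where
  "clique E K \<longleftrightarrow> (\<forall>x\<in>K. \<forall>y\<in>K. x \<noteq> y \<longrightarrow> E x y)"

text \<open>Clique number and chromatic number of the induced subgraph G|X.\<close>
definition clique_number :: "('a \<Rightarrow> 'a \<Rightarrow> bool) \<Rightarrow> 'a set \<Rightarrow> nat" where
  "clique_number E X = Max {card K | K. K \<subseteq> X \<and> clique E K}"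

definition chromatic_number :: "('a \<Rightarrow> 'a \<Rightarrow> bool) \<Rightarrow> 'a set \<Rightarrow> nat" where
  "chromatic_number E X = (LEAST k. \<exists>c :: 'a \<Rightarrow> nat.
      (\<forall>x\<in>X. c x < k) \<and> (\<forall>x\<in>X. \<forall>y\<in>X. E x y \<longrightarrow> c x \<noteq> c y))"

definition perfect :: "'a set \<Rightarrow> ('a \<Rightarrow> 'a \<Rightarrow> bool) \<Rightarrow> bool" where
  "perfect V E \<longleftrightarrow> (\<forall>X\<subseteq>V. chromatic_number E X = clique_number E X)"

text \<open>Minimum imperfect: Berge, not perfect, and every Berge graph with fewer
  vertices is perfect (graphs on the same vertex type; every smaller graph
  has an isomorphic copy on a subset of V).\<close>
definition minimum_imperfect :: "'a set \<Rightarrow> ('a \<Rightarrow> 'a \<Rightarrow> bool) \<Rightarrow> bool" where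
  "minimum_imperfect V E \<longleftrightarrow> graph V E \<and> berge V E \<and> \<not> perfect V E \<and>
     (\<forall>(V' :: 'a set) E'. graph V' E' \<and> berge V' E' \<and> card V' < card V \<longrightarrow> perfect V' E')"

text \<open>G|X connected (the empty set counts as connected).\<close>
definition connected_in :: "('a \<Rightarrow> 'a \<Rightarrow> bool) \<Rightarrow> 'a set \<Rightarrow> bool" where
  "connected_in E X \<longleftrightarrow>
     (\<forall>x\<in>X. \<forall>y\<in>X. (x, y) \<in> {(u, v). u \<in> X \<and> v \<in> X \<and> E u v}\<^sup>*)"

definition anticonnected_in :: "('a \<Rightarrow> 'a \<Rightarrow> bool) \<Rightarrow> 'a set \<Rightarrow> bool" where
  "anticonnected_in E X \<longleftrightarrow> connected_in (co E) X"

definition component :: "('a \<Rightarrow> 'a \<Rightarrow> bool) \<Rightarrow> 'a set \<Rightarrow> 'a set \<Rightarrow> bool" where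
  "component E X C \<longleftrightarrow> C \<noteq> {} \<and> C \<subseteq> X \<and> connected_in E C \<and>
     (\<forall>D. C \<subseteq> D \<and> D \<subseteq> X \<and> connected_in E D \<longrightarrow> D = C)"

definition anticomponent :: "('a \<Rightarrow> 'a \<Rightarrow> bool) \<Rightarrow> 'a set \<Rightarrow> 'a set \<Rightarrow> bool" where
  "anticomponent E X C \<longleftrightarrow> component (co E) X C"

definition skew_partition :: "'a set \<Rightarrow> ('a \<Rightarrow> 'a \<Rightarrow> bool) \<Rightarrow> 'a set \<Rightarrow> 'a set \<Rightarrow> bool" where
  "skew_partition V E A B \<longleftrightarrow> A \<union> B = V \<and> A \<inter> B = {} \<and>
     \<not> connected_in E A \<and> \<not> anticonnected_in E B"

text \<open>Balanced: no odd path between nonadjacent vertices of B with interior in A,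
  no odd antipath between adjacent vertices of A with interior in B.
  A path with vertex list vs has length (length vs - 1), which is odd iff
  length vs is even.\<close>
definition balanced :: "'a set \<Rightarrow> ('a \<Rightarrow> 'a \<Rightarrow> bool) \<Rightarrow> 'a set \<Rightarrow> 'a set \<Rightarrow> bool" where
  "balanced V E A B \<longleftrightarrow>
     (\<nexists>vs. ind_path V E vs \<and> odd (length vs - 1) \<and> hd vs \<in> B \<and> last vs \<in> B \<and>
           \<not> E (hd vs) (last vs) \<and> set (butlast (tl vs)) \<subseteq> A) \<and>
     (\<nexists>vs. ind_path V (co E) vs \<and> odd (length vs - 1) \<and> hd vs \<in> A \<and> last vs \<in> A \<and>
           E (hd vs) (last vs) \<and> set (butlast (tl vs)) \<subseteq> B)"

definition loose :: "'a set \<Rightarrow> ('a \<Rightarrow> 'a \<Rightarrow> bool) \<Rightarrow> 'a set \<Rightarrow> 'a set \<Rightarrow> bool" where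
  "loose V E A B \<longleftrightarrow>
     (\<exists>b\<in>B. \<exists>C. component E A C \<and> (\<forall>c\<in>C. \<not> E b c)) \<or>
     (\<exists>a\<in>A. \<exists>D. anticomponent E B D \<and> (\<forall>d\<in>D. E a d))"

end

theory Submission
  imports Defs
begin

text \<open>
  Split the vertex set of a minimum imperfect graph along a skew partition into \<open>A1, A2\<close>
  (no edges between them) and \<open>B1, B2\<close> (complete to each other), and let \<open>k\<close> and \<open>b\<close>
  be the clique numbers of the graph and of \<open>B2\<close>. For each \<open>i\<close> add to the graph induced on
  \<open>Ai \<union> B1 \<union> B2\<close> a vertex with neighbourhood \<open>B2\<close>. If there are no odd paths or antipaths between
  \<open>Ai\<close> and \<open>B2\<close> this graph is Berge, and it is smaller than the original one, hence perfect.
  Replicating the new vertex \<open>k - b\<close> times and colouring with \<open>k\<close> colours forces \<open>B2\<close> to use only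
  \<open>b\<close> colours. The vertices receiving these \<open>b\<close> colours for \<open>i = 1, 2\<close> form a proper subset of
  clique number \<open>b\<close> whose complement has clique number \<open>k - b\<close>, and colouring the two
  pieces separately colours the graph with \<open>k\<close> colours.

  This settles balanced skew partitions. In a loose one, after complementation, some \<open>v \<in> B1\<close>
  has no neighbour in the component \<open>A1\<close>. Moving to \<open>A2\<close> the vertices of \<open>B2\<close> without neighbours
  in \<open>A1\<close>, the same colouring argument applies: odd paths and antipaths between \<open>A1\<close> and \<open>B2\<close> close up
  with \<open>v\<close> to odd holes and antiholes, odd paths through \<open>A2\<close> close up with even paths through \<open>A1\<close>,
  and odd antipaths between \<open>A2\<close> and \<open>B2\<close> are excluded by a weak form of the Roussel--Rubio lemma
  applied in the complement with the anticonnected set \<open>A1\<close>. That each of the four parts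
  has at least two vertices comes from Chvatal's star cutset lemma and Lovasz's perfect graph theorem.
\<close>

section \<open>Induced paths and holes\<close>

lemma ind_path_appendI:
  assumes "symp E" "ind_path V E us" "ind_path V E ws" "set us \<inter> set ws = {}"
    and "E (last us) (hd ws)"
    and only: "\<And>u w. u \<in> set us \<Longrightarrow> w \<in> set ws \<Longrightarrow> E u w \<Longrightarrow> u = last us \<and> w = hd ws"
  shows "ind_path V E (us @ ws)"
proof -
  have us: "us \<noteq> []" "distinct us" "set us \<subseteq> V"
    and ws: "ws \<noteq> []" "distinct ws" "set ws \<subseteq> V"
    and usE: "\<And>i j. i < length us \<Longrightarrow> j < length us \<Longrightarrow> E (us!i) (us!j) \<longleftrightarrow> i = Suc j \<or> j = Suc i"
    and wsE: "\<And>i j. i < length ws \<Longrightarrow> j < length ws \<Longrightarrow> E (ws!i) (ws!j) \<longleftrightarrow> i = Suc j \<or> j = Suc i"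
    using assms(2,3) by (auto simp: ind_path_def)
  have cross: "E (us!i) (ws!j) \<longleftrightarrow> Suc i = length us \<and> j = 0"
    if "i < length us" "j < length ws" for i j
  proof
    assume "E (us!i) (ws!j)"
    then have "us!i = last us \<and> ws!j = hd ws" using that by (intro only) auto
    then show "Suc i = length us \<and> j = 0"
      using us ws that by (auto simp: last_conv_nth hd_conv_nth nth_eq_iff_index_eq)
  next
    assume *: "Suc i = length us \<and> j = 0"
    then have "i = length us - 1" by linarith
    then have "last us = us!i" "hd ws = ws!j" using us ws * by (simp_all add: last_conv_nth hd_conv_nth)
    then show "E (us!i) (ws!j)" using assms(5) by simp
  qed
  have sym: "E a b \<longleftrightarrow> E b a" for a b using sympD[OF assms(1)] by blast
  have "E ((us@ws)!i) ((us@ws)!j) \<longleftrightarrow> i = Suc j \<or> j = Suc i"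
    if "i < length (us@ws)" "j < length (us@ws)" for i j
  proof (cases "i < length us"; cases "j < length us")
    assume "i < length us" "j < length us"
    then show ?thesis using usE by (simp add: nth_append)
  next
    assume "i < length us" "\<not> j < length us"
    then show ?thesis using cross[of i "j - length us"] that by (auto simp: nth_append)
  next
    assume "\<not> i < length us" "j < length us"
    then show ?thesis using cross[of j "i - length us"] that sym by (auto simp: nth_append)
  next
    assume "\<not> i < length us" "\<not> j < length us"
    then show ?thesis using wsE[of "i - length us" "j - length us"] that by (auto simp: nth_append)
  qed
  then show ?thesis using us ws assms(4) by (auto simp: ind_path_def)
qed

lemma ind_path_singleton [simp]: "ind_path V E [x] \<longleftrightarrow> x \<in> V \<and> \<not> E x x"
  by (auto simp: ind_path_def)

lemma ind_path_ConsI: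
  assumes "symp E" "irreflp E" "ind_path V E ws" "x \<in> V" "x \<notin> set ws" "E x (hd ws)"
    and "\<And>w. w \<in> set ws \<Longrightarrow> E x w \<Longrightarrow> w = hd ws"
  shows "ind_path V E (x # ws)"
  using ind_path_appendI[of E V "[x]" ws] assms by (auto dest: irreflpD)

lemma ind_path_snocI:
  assumes "symp E" "irreflp E" "ind_path V E us" "x \<in> V" "x \<notin> set us" "E (last us) x"
    and "\<And>u. u \<in> set us \<Longrightarrow> E u x \<Longrightarrow> u = last us"
  shows "ind_path V E (us @ [x])"
  using ind_path_appendI[of E V us "[x]"] assms by (auto dest: irreflpD)

lemma ind_path_sub:
  assumes "ind_path V E (us @ vs @ ws)" "vs \<noteq> []"
  shows "ind_path V E vs"
proof -
  have nth: "vs ! i = (us @ vs @ ws) ! (length us + i)" if "i < length vs" for i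
    using that by (simp add: nth_append)
  have "E ((us@vs@ws)!(length us + i)) ((us@vs@ws)!(length us + j)) \<longleftrightarrow> i = Suc j \<or> j = Suc i"
    if "i < length vs" "j < length vs" for i j
    using assms(1) that unfolding ind_path_def by (auto simp del: nth_append_length_plus)
  then have "\<forall>i<length vs. \<forall>j<length vs. E (vs!i) (vs!j) \<longleftrightarrow> i = Suc j \<or> j = Suc i"
    by (simp add: nth)
  then show ?thesis using assms by (auto simp: ind_path_def)
qed

lemma ind_path_rev: 
  assumes "ind_path V E vs"
  shows "ind_path V E (rev vs)"
proof -
  have E: "E (vs!i) (vs!j) \<longleftrightarrow> i = Suc j \<or> j = Suc i" if "i < length vs" "j < length vs" for i j
    using assms that by (auto simp: ind_path_def)
  have "E (rev vs ! i) (rev vs ! j) \<longleftrightarrow> i = Suc j \<or> j = Suc i" if "i < length vs" "j < length vs" for i j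
    using that by (auto simp: rev_nth E)
  then show ?thesis using assms by (simp add: ind_path_def)
qed

lemma ind_path_mono: "ind_path V E vs \<Longrightarrow> V \<subseteq> W \<Longrightarrow> ind_path W E vs"
  by (auto simp: ind_path_def)

lemma ind_path_cong:
  assumes "ind_path V E vs" "set vs \<subseteq> W" "\<And>x y. x \<in> set vs \<Longrightarrow> y \<in> set vs \<Longrightarrow> E x y \<longleftrightarrow> F x y"
  shows "ind_path W F vs"
  using assms unfolding ind_path_def by auto

lemma hole_cong:
  assumes "hole V E vs" "set vs \<subseteq> W" "\<And>x y. x \<in> set vs \<Longrightarrow> y \<in> set vs \<Longrightarrow> E x y \<longleftrightarrow> F x y"
  shows "hole W F vs"
  using assms unfolding hole_def by auto

lemma ind_path_adj:
  assumes "ind_path V E vs" "i < length vs" "j < length vs"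
  shows "E (vs!i) (vs!j) \<longleftrightarrow> i = Suc j \<or> j = Suc i"
  using assms by (auto simp: ind_path_def)

text \<open>Every wrap-around adjacency in a cyclic list involves position 0, so between the
  positions \<open>Suc i\<close> and \<open>Suc j\<close> only linear adjacency survives.\<close>

lemma cyclic_succ_Suc:
  fixes i j n :: nat
  assumes "i < n" "j < n"
  shows "Suc j = Suc (Suc i) mod Suc n \<or> Suc i = Suc (Suc j) mod Suc n \<longleftrightarrow> i = Suc j \<or> j = Suc i"
proof -
  have "Suc (Suc k) mod Suc n = (if Suc k = n then 0 else Suc (Suc k))" if "k < n" for k
    using that by simp
  then show ?thesis using assms by (auto split: if_splits)
qed

text \<open>Seen from one of its vertices, a hole is an induced path whose ends are the only
  neighbours of that vertex. The parity arguments below build holes in this form, and antiholes by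
  taking \<open>co E\<close> as the relation.\<close>

lemma hole_ConsI:
  assumes "symp E" "irreflp E" "ind_path V E ps" "length ps \<ge> 3" "z \<in> V" "z \<notin> set ps"
    and "E z (hd ps)" "E z (last ps)"
    and only: "\<And>p. p \<in> set ps \<Longrightarrow> E z p \<Longrightarrow> p = hd ps \<or> p = last ps"
  shows "hole V E (z # ps)"
proof -
  let ?n = "length ps"
  have ps: "distinct ps" "ps \<noteq> []" "set ps \<subseteq> V" using assms(3) by (auto simp: ind_path_def)
  have z: "E z (ps!i) \<longleftrightarrow> i = 0 \<or> Suc i = ?n" if "i < ?n" for i
  proof
    assume "E z (ps!i)"
    then have "ps!i = hd ps \<or> ps!i = last ps" using only that by auto
    then show "i = 0 \<or> Suc i = ?n"
      using ps that by (auto simp: last_conv_nth hd_conv_nth nth_eq_iff_index_eq)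
  next
    assume "i = 0 \<or> Suc i = ?n"
    then have "i = 0 \<or> i = ?n - 1" by auto
    then show "E z (ps!i)"
      using assms(7,8) ps by (auto simp: hd_conv_nth last_conv_nth)
  qed
  have sym: "E a b \<longleftrightarrow> E b a" for a b using sympD[OF assms(1)] by blast
  have zz: "\<not> E z z" using assms(2) by (auto dest: irreflpD)
  have S: "Suc k mod Suc ?n = (if k = ?n then 0 else Suc k)" if "k \<le> ?n" for k
    using that by simp
  have "E ((z#ps)!i) ((z#ps)!j) \<longleftrightarrow> j = Suc i mod length (z#ps) \<or> i = Suc j mod length (z#ps)"
    if "i < length (z#ps)" "j < length (z#ps)" for i j
  proof (cases i; cases j)
    assume "i = 0" "j = 0"
    then show ?thesis using zz assms(4) by auto
  next
    fix j' assume "i = 0" "j = Suc j'"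
    then show ?thesis using z[of j'] that assms(4) by (auto simp: S)
  next
    fix i' assume "i = Suc i'" "j = 0"
    then show ?thesis using z[of i'] that assms(4) sym[of _ z] by (auto simp: S)
  next
    fix i' j' assume "i = Suc i'" "j = Suc j'"
    then show ?thesis
      using ind_path_adj[OF assms(3), of i' j'] cyclic_succ_Suc[of i' ?n j'] that by simp
  qed
  then show ?thesis using ps assms by (auto simp: hole_def)
qed

lemma hole_ConsD:
  assumes "hole V E (z # ps)"
  shows "ind_path V E ps" "z \<notin> set ps" "length ps \<ge> 3" "E z (hd ps)" "E z (last ps)"
    and "\<And>p. p \<in> set ps \<Longrightarrow> E z p \<Longrightarrow> p = hd ps \<or> p = last ps"
proof -
  let ?n = "length ps"
  have len: "?n \<ge> 3" and d: "distinct (z#ps)" "set (z#ps) \<subseteq> V"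
    and adj: "\<And>i j. i < Suc ?n \<Longrightarrow> j < Suc ?n \<Longrightarrow> E ((z#ps)!i) ((z#ps)!j) \<longleftrightarrow> 
       j = Suc i mod Suc ?n \<or> i = Suc j mod Suc ?n"
    using assms by (auto simp: hole_def)
  have ps: "ps \<noteq> []" using len by auto
  have S: "Suc k mod Suc ?n = (if k = ?n then 0 else Suc k)" if "k \<le> ?n" for k
    using that by simp
  have in_ps: "E (ps!i) (ps!j) \<longleftrightarrow> i = Suc j \<or> j = Suc i" if "i < ?n" "j < ?n" for i j
  proof -
    have "E (ps!i) (ps!j) \<longleftrightarrow> Suc j = Suc (Suc i) mod Suc ?n \<or> Suc i = Suc (Suc j) mod Suc ?n"
      using adj[of "Suc i" "Suc j"] that by simp
    also have "\<dots> \<longleftrightarrow> i = Suc j \<or> j = Suc i"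
      using that by (intro cyclic_succ_Suc)
    finally show ?thesis .
  qed
  have z: "E z (ps!i) \<longleftrightarrow> i = 0 \<or> Suc i = ?n" if "i < ?n" for i
  proof -
    have "E z (ps!i) \<longleftrightarrow> Suc i = 1 mod Suc ?n \<or> 0 = Suc (Suc i) mod Suc ?n"
      using adj[of 0 "Suc i"] that by simp
    also have "\<dots> \<longleftrightarrow> i = 0 \<or> Suc i = ?n"
      using that len S[of "Suc i"] S[of 0] by (simp split: if_splits)
    finally show ?thesis .
  qed
  show "ind_path V E ps" using ps d in_ps by (auto simp: ind_path_def)
  show "z \<notin> set ps" "?n \<ge> 3" using d len by auto
  show "E z (hd ps)" "E z (last ps)" using z[of 0] z[of "?n - 1"] ps by (auto simp: hd_conv_nth last_conv_nth)
  fix p assume "p \<in> set ps" "E z p"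
  then obtain i where "i < ?n" "p = ps!i" by (auto simp: in_set_conv_nth)
  moreover from this have "i = 0 \<or> i = ?n - 1" using z[of i] \<open>E z p\<close> by auto
  ultimately show "p = hd ps \<or> p = last ps" using ps
    by (metis hd_conv_nth last_conv_nth)
qed

lemma hole_rotate1:
  assumes "hole V E vs"
  shows "hole V E (rotate1 vs)"
proof -
  let ?n = "length vs"
  have n: "?n \<ge> 4" using assms by (simp add: hole_def)
  have adj: "E (vs!i) (vs!j) \<longleftrightarrow> j = Suc i mod ?n \<or> i = Suc j mod ?n" if "i < ?n" "j < ?n" for i j
    using assms that by (auto simp: hole_def)
  have S: "Suc k mod ?n = (if Suc k = ?n then 0 else Suc k)" if "k < ?n" for k using that by auto
  have "E (rotate1 vs!i) (rotate1 vs!j) \<longleftrightarrow> j = Suc i mod ?n \<or> i = Suc j mod ?n" if "i < ?n" "j < ?n" for i j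
  proof -
    have "E (rotate1 vs!i) (rotate1 vs!j) \<longleftrightarrow> E (vs!(Suc i mod ?n)) (vs!(Suc j mod ?n))"
      using that by (simp add: nth_rotate1)
    also have "\<dots> \<longleftrightarrow> Suc j mod ?n = Suc (Suc i mod ?n) mod ?n \<or> Suc i mod ?n = Suc (Suc j mod ?n) mod ?n"
      using that by (intro adj mod_less_divisor) linarith+
    also have "\<dots> \<longleftrightarrow> j = Suc i mod ?n \<or> i = Suc j mod ?n"
      using that n by (cases "Suc i = ?n"; cases "Suc j = ?n"; cases "Suc (Suc i) = ?n"; cases "Suc (Suc j) = ?n") simp_all
    finally show ?thesis .
  qed
  then show ?thesis using assms by (simp add: hole_def)
qed

text \<open>Holes are invariant under rotation, so a chosen vertex can be moved to the front before
  \<open>hole_ConsD\<close> is applied.\<close>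

lemma hole_rotate_to:
  assumes "hole V E vs" "z \<in> set vs"
  obtains ps where "hole V E (z # ps)" "length vs = Suc (length ps)"
proof -
  have rot: "hole V E (rotate k vs)" for k
    using assms(1) by (induction k) (auto intro: hole_rotate1)
  obtain us ws where vs: "vs = us @ z # ws" using assms(2) by (meson split_list)
  have "rotate (length us) vs = z # ws @ us" unfolding vs by (simp add: rotate_append)
  then have "hole V E (z # ws @ us)" using rot by metis
  then show thesis using that vs by simp
qed

lemma ind_path_exists:
  assumes "symp R" "irreflp R" "(x, y) \<in> {(u, v). u \<in> D \<and> v \<in> D \<and> R u v}\<^sup>*" "x \<in> D"
  shows "\<exists>qs. ind_path D R qs \<and> hd qs = x \<and> last qs = y"
  using assms(3)
proof (induction rule: rtrancl_induct)
  case base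
  then show ?case using assms by (intro exI[of _ "[x]"]) (auto dest: irreflpD)
next
  case (step y z)
  then obtain qs where qs: "ind_path D R qs" "hd qs = x" "last qs = y" by blast
  have yz: "y \<in> D" "z \<in> D" "R y z" using step by auto
  have ne: "qs \<noteq> []" "distinct qs" using qs by (auto simp: ind_path_def)
  \<comment> \<open>The path is cut at its first vertex that equals \<open>z\<close> or is adjacent
    to \<open>z\<close>; no earlier vertex then spoils inducedness when \<open>z\<close> is
    appended.\<close>
  let ?P = "\<lambda>k. k < length qs \<and> (qs!k = z \<or> R (qs!k) z)"
  have "?P (length qs - 1)" using qs ne yz by (auto simp: last_conv_nth)
  define k where "k = (LEAST k. ?P k)"
  have k: "?P k" unfolding k_def by (rule LeastI[of ?P], fact)
  have least: "\<not> ?P i" if "i < k" for i using that not_less_Least unfolding k_def by blast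
  let ?t = "take (Suc k) qs"
  have t: "ind_path D R ?t"
    using ind_path_sub[of D R "[]" ?t "drop (Suc k) qs"] qs ne by simp
  have hd: "hd ?t = x" using qs ne by (cases qs) auto
  have last: "last ?t = qs!k" using k by (simp add: take_Suc_conv_app_nth)
  show ?case
  proof (cases "qs!k = z")
    case True
    then show ?thesis using t hd last by blast
  next
    case False
    have nth: "\<exists>i\<le>k. u = qs!i" if "u \<in> set ?t" for u 
      using that k by (auto simp: in_set_conv_nth less_Suc_eq_le)
    have "z \<notin> set ?t"
    proof
      assume "z \<in> set ?t"
      then obtain i where i: "i \<le> k" "z = qs!i" using nth by blast
      then show False using least[of i] k False by (cases "i = k") auto
    qed
    moreover have "u = last ?t" if u: "u \<in> set ?t" "R u z" for u
    proof -
      obtain i where i: "i \<le> k" "u = qs!i" using nth u by blast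
      then show ?thesis using least[of i] k u last by (cases "i = k") auto
    qed
    moreover have "R (last ?t) z" using last k False by simp
    ultimately have "ind_path D R (?t @ [z])"
      using t yz by (intro ind_path_snocI assms) auto
    then show ?thesis using hd ne by (intro exI[of _ "?t @ [z]"]) (auto simp: hd_append)
  qed
qed

lemma connected_in_path:
  assumes "symp R" "irreflp R" "connected_in R D" "x \<in> D" "y \<in> D"
  obtains qs where "ind_path D R qs" "hd qs = x" "last qs = y"
  using ind_path_exists[of R x y D] assms unfolding connected_in_def by blast

section \<open>Connected sets\<close>

lemma symp_co: "symp E \<Longrightarrow> symp (co E)"
  by (auto simp: symp_def co_def)

lemma irreflp_co: "irreflp (co E)"
  by (auto simp: irreflp_def co_def)

text \<open>Reachability is traded for cuts: a walk out of \<open>P\<close> crosses its boundary,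
  and conversely no edge leaves the set of vertices reachable from \<open>x\<close>.\<close>

lemma connected_in_iff:
  assumes "symp R"
  shows "connected_in R D \<longleftrightarrow> (\<forall>P\<subseteq>D. P \<noteq> {} \<and> P \<noteq> D \<longrightarrow> (\<exists>p\<in>P. \<exists>q\<in>D-P. R p q))"
proof (intro iffI allI impI)
  fix P assume conn: "connected_in R D" and P: "P \<subseteq> D" "P \<noteq> {} \<and> P \<noteq> D"
  then obtain p q where pq: "p \<in> P" "q \<in> D - P" by blast
  have "(p, q) \<in> {(u, v). u \<in> D \<and> v \<in> D \<and> R u v}\<^sup>*"
    using conn pq P unfolding connected_in_def by blast
  then have "q \<in> P \<or> (\<exists>p\<in>P. \<exists>q\<in>D-P. R p q)"
    by (induction rule: rtrancl_induct) (use pq in auto)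
  then show "\<exists>p\<in>P. \<exists>q\<in>D-P. R p q" using pq by blast
next
  assume cross: "\<forall>P\<subseteq>D. P \<noteq> {} \<and> P \<noteq> D \<longrightarrow> (\<exists>p\<in>P. \<exists>q\<in>D-P. R p q)"
  have "(x, y) \<in> {(u, v). u \<in> D \<and> v \<in> D \<and> R u v}\<^sup>*" if "x \<in> D" "y \<in> D" for x y
  proof -
    let ?P = "{z\<in>D. (x, z) \<in> {(u, v). u \<in> D \<and> v \<in> D \<and> R u v}\<^sup>*}"
    have "?P = D"
    proof (rule ccontr)
      assume "?P \<noteq> D"
      moreover have "x \<in> ?P" using that by simp
      ultimately obtain p q where "p \<in> ?P" "q \<in> D - ?P" "R p q"
        using cross[rule_format, of ?P] by blast
      then have "(x, q) \<in> {(u, v). u \<in> D \<and> v \<in> D \<and> R u v}\<^sup>*"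
        by (auto intro: rtrancl_into_rtrancl)
      then show False using \<open>q \<in> D - ?P\<close> by blast
    qed
    then show ?thesis using that by blast
  qed
  then show "connected_in R D" unfolding connected_in_def by blast
qed

lemma connected_in_cross:
  assumes "symp R" "connected_in R D" "P \<subseteq> D" "P \<noteq> {}" "P \<noteq> D"
  obtains p q where "p \<in> P" "q \<in> D - P" "R p q"
  using assms connected_in_iff[of R D] by blast

lemma not_connected_split:
  assumes "symp R" "\<not> connected_in R D"
  obtains P Q where "P \<union> Q = D" "P \<inter> Q = {}" "P \<noteq> {}" "Q \<noteq> {}" "\<And>p q. p \<in> P \<Longrightarrow> q \<in> Q \<Longrightarrow> \<not> R p q"
proof -
  obtain P where "P \<subseteq> D" "P \<noteq> {}" "P \<noteq> D" "\<not> (\<exists>p\<in>P. \<exists>q\<in>D-P. R p q)"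
    using assms connected_in_iff[of R D] by blast
  then show thesis using that[of P "D - P"] by blast
qed

lemma connected_in_Un:
  assumes "symp R" "connected_in R A" "connected_in R B" "c \<in> A" "c \<in> B"
  shows "connected_in R (A \<union> B)"
proof (subst connected_in_iff[OF assms(1)], intro allI impI)
  fix P assume P: "P \<subseteq> A \<union> B" "P \<noteq> {} \<and> P \<noteq> A \<union> B"
  show "\<exists>p\<in>P. \<exists>q\<in>A \<union> B - P. R p q"
  proof (rule ccontr)
    assume none: "\<not> ?thesis"
    have all: "P \<inter> D = {} \<or> D \<subseteq> P" if "connected_in R D" "D \<subseteq> A \<union> B" for D
      using connected_in_cross[OF assms(1) that(1), of "P \<inter> D"] none that(2) by blast
    have "P \<inter> A = {} \<or> A \<subseteq> P" "P \<inter> B = {} \<or> B \<subseteq> P"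
      using all assms(2,3) by simp_all
    then show False using P assms(4,5) by blast
  qed
qed

lemma connected_in_singleton: "connected_in R {x}"
  by (simp add: connected_in_def)

lemma connected_in_insert:
  assumes "symp R" "connected_in R D" "d \<in> D" "R d x"
  shows "connected_in R (insert x D)"
proof -
  have "connected_in R {d, x}"
  proof (subst connected_in_iff[OF assms(1)], intro allI impI)
    fix P assume "P \<subseteq> {d, x}" "P \<noteq> {} \<and> P \<noteq> {d, x}"
    then have "d \<noteq> x" "P = {d} \<or> P = {x}" by blast+
    then show "\<exists>p\<in>P. \<exists>q\<in>{d, x} - P. R p q" using assms(4) sympD[OF assms(1,4)] by blast
  qed
  then show ?thesis using connected_in_Un[OF assms(1,2), of "{d, x}" d] assms(3)
    by (simp add: insert_absorb)
qed

text \<open>A maximal connected proper subset of \<open>D\<close> containing \<open>D0\<close> has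
  an edge to the rest of \<open>D\<close>; adding the outer end of this edge must give
  \<open>D\<close>, so exactly one vertex was missing.\<close>

lemma connected_in_remove_outside:
  assumes "symp R" "finite D" "connected_in R D" "connected_in R D0" "D0 \<noteq> {}" "D0 \<subset> D"
  obtains y where "y \<in> D - D0" "connected_in R (D - {y})"
proof -
  define F where "F = {M. D0 \<subseteq> M \<and> M \<subset> D \<and> connected_in R M}"
  have F: "M \<in> F \<longleftrightarrow> D0 \<subseteq> M \<and> M \<subset> D \<and> connected_in R M" for M by (simp add: F_def)
  have "finite F" by (rule finite_subset[of _ "Pow D"]) (use assms F in auto)
  moreover have "F \<noteq> {}" using assms F by blast
  ultimately obtain M where "M \<in> F" and max: "\<And>N. N \<in> F \<Longrightarrow> M \<subseteq> N \<Longrightarrow> M = N"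
    using finite_has_maximal[of F] by auto
  then have M: "D0 \<subseteq> M" "M \<subset> D" "connected_in R M" using F by auto
  obtain p q where pq: "p \<in> M" "q \<in> D - M" "R p q"
    using connected_in_cross[OF assms(1,3), of M] assms(5) M by blast
  have "connected_in R (insert q M)" using connected_in_insert[OF assms(1) M(3) pq(1,3)] .
  then have "\<not> insert q M \<subset> D" using max[of "insert q M"] F M pq by blast
  then have "M = D - {q}" using pq M by blast
  then show thesis using that[of q] M pq by blast
qed

text \<open>The vertex \<open>c\<close> separates \<open>K\<close> from \<open>L\<close>. A cut of
  \<open>insert c K\<close> becomes a cut of \<open>X\<close> when \<open>L\<close> is put on the
  side of \<open>c\<close>, and an edge crossing that cut cannot have an end in
  \<open>L\<close>.\<close>

lemma connected_in_side:
  assumes "symp R" "connected_in R X" "c \<in> X" "K \<union> L = X - {c}" "K \<inter> L = {}"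
    and KL: "\<And>k l. k \<in> K \<Longrightarrow> l \<in> L \<Longrightarrow> \<not> R k l"
  shows "connected_in R (insert c K)"
proof (subst connected_in_iff[OF assms(1)], intro allI impI)
  have LK: "\<not> R l k" if "k \<in> K" "l \<in> L" for k l using KL[OF that] assms(1) by (auto dest: sympD)
  fix P assume P: "P \<subseteq> insert c K" "P \<noteq> {} \<and> P \<noteq> insert c K"
  show "\<exists>p\<in>P. \<exists>q\<in>insert c K - P. R p q"
  proof (cases "c \<in> P")
    case False
    then have "P \<subseteq> K" "P \<noteq> X" using P assms by auto
    then obtain p q where "p \<in> P" "q \<in> X - P" "R p q"
      using connected_in_cross[OF assms(1,2), of P] P assms by blast
    then show ?thesis using KL assms(4) \<open>P \<subseteq> K\<close> by blast
  next
    case True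
    have "P \<union> L \<noteq> X" using P assms(3-5) True by blast
    moreover have "P \<union> L \<subseteq> X" using P assms(3,4) by blast
    ultimately obtain p q where "p \<in> P \<union> L" "q \<in> X - (P \<union> L)" "R p q"
      using connected_in_cross[OF assms(1,2), of "P \<union> L"] True by blast
    then show ?thesis using LK assms(4) True by blast
  qed
qed

text \<open>On each side of the cut vertex, \<open>connected_in_remove_outside\<close> deletes a
  vertex while \<open>c\<close> and the rest of that side stay connected. Applied to
  \<open>co E\<close>, this supplies the pair required by \<open>no_cut_pair\<close>.\<close>

lemma cut_vertex_ends:
  assumes "symp R" "finite X" "connected_in R X" "c \<in> X" "\<not> connected_in R (X - {c})"
  obtains x y where "x \<in> X" "y \<in> X" "x \<noteq> y" "\<not> R x y" "c \<noteq> x" "c \<noteq> y"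
    "connected_in R (X - {x})" "connected_in R (X - {y})" "connected_in R (X - {x, y})"
proof -
  obtain K L where KL: "K \<union> L = X - {c}" "K \<inter> L = {}" "K \<noteq> {}" "L \<noteq> {}"
      "\<And>p q. p \<in> K \<Longrightarrow> q \<in> L \<Longrightarrow> \<not> R p q"
    using not_connected_split[OF assms(1,5)] by metis
  have LK: "\<not> R l k" if "k \<in> K" "l \<in> L" for k l using KL(5)[OF that] assms(1) by (auto dest: sympD)
  have cK: "connected_in R (insert c K)"
    by (rule connected_in_side[OF assms(1,3,4)]) (use KL in blast)+
  have cL: "connected_in R (insert c L)"
    by (rule connected_in_side[OF assms(1,3,4), of L K]) (use KL LK in blast)+
  have c1: "connected_in R {c}" by (rule connected_in_singleton)
  have fin: "finite (insert c K)" "finite (insert c L)"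
    using assms(2,4) KL(1) by (auto intro: finite_subset)
  obtain x where x: "x \<in> insert c K - {c}" "connected_in R (insert c K - {x})"
    by (rule connected_in_remove_outside[OF assms(1) fin(1) cK, of "{c}"])
       (use KL c1 in \<open>simp_all, blast+\<close>)
  obtain y where y: "y \<in> insert c L - {c}" "connected_in R (insert c L - {y})"
    by (rule connected_in_remove_outside[OF assms(1) fin(2) cL, of "{c}"])
       (use KL c1 in \<open>simp_all, blast+\<close>)
  have c: "c \<in> insert c K - {x}" "c \<in> insert c L - {y}" "c \<in> insert c K" "c \<in> insert c L"
    using x y by blast+
  have "X - {x} = (insert c K - {x}) \<union> insert c L" "X - {y} = insert c K \<union> (insert c L - {y})"
     "X - {x, y} = (insert c K - {x}) \<union> (insert c L - {y})"
    using x y KL assms(4) by blast+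
  then have "connected_in R (X - {x})" "connected_in R (X - {y})" "connected_in R (X - {x, y})"
    using connected_in_Un[OF assms(1) x(2) cL c(1,4)] connected_in_Un[OF assms(1) cK y(2) c(3,2)]
      connected_in_Un[OF assms(1) x(2) y(2) c(1,2)] by (simp_all only:)
  then show thesis using that[of x y] x y KL by blast
qed

text \<open>An edge leaving the closed neighbourhood of \<open>a\<close> starts at a neighbour of
  \<open>a\<close>, which becomes the middle vertex.\<close>

lemma distance_two:
  assumes "symp R" "connected_in R X" "a \<in> X" "b \<in> X" "a \<noteq> b" "\<not> R a b"
  obtains x c y where "x \<in> X" "c \<in> X" "y \<in> X" "x \<noteq> c" "c \<noteq> y" "x \<noteq> y" "R x c" "R c y" "\<not> R x y"
proof -
  let ?P = "insert a {z\<in>X. R a z}"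
  have "?P \<subseteq> X" "?P \<noteq> {}" "b \<notin> ?P" using assms by auto
  moreover from this have "?P \<noteq> X" using assms(4) by blast
  ultimately obtain p q where "p \<in> ?P" "q \<in> X - ?P" "R p q"
    using connected_in_cross[OF assms(1,2), of ?P] by metis
  then show thesis using that[of a p q] assms by blast
qed

section \<open>A weak Roussel--Rubio lemma\<close>

text \<open>Consecutive marks are at even distance or at distance 1, so modulo 2 the whole distance
  counts the gaps of length 1. The induction splits at the last mark \<open>c\<close> before
  \<open>b\<close>.\<close>

lemma gap_parity:
  fixes M :: "nat \<Rightarrow> bool"
  assumes gap: "\<And>i j. a \<le> i \<Longrightarrow> i < j \<Longrightarrow> j \<le> b \<Longrightarrow> M i \<Longrightarrow> M j \<Longrightarrow> (\<And>k. i < k \<Longrightarrow> k < j \<Longrightarrow> \<not> M k)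
      \<Longrightarrow> odd (j - i) \<Longrightarrow> j = Suc i"
    and "a \<le> b" "M a" "M b"
  shows "odd (card {i. a \<le> i \<and> i < b \<and> M i \<and> M (Suc i)}) \<longleftrightarrow> odd (b - a)"
  using assms
proof (induction b rule: less_induct)
  case (less b)
  show ?case
  proof (cases "a = b")
    case True
    then have none: "{i. a \<le> i \<and> i < b \<and> M i \<and> M (Suc i)} = {}" by auto
    show ?thesis unfolding none using True by simp
  next
    case False
    define S where "S = {k. a \<le> k \<and> k < b \<and> M k}"
    define c where "c = Max S"
    have "finite S" "a \<in> S" using less.prems False by (auto simp: S_def)
    then have "c \<in> S" and ge: "k \<in> S \<Longrightarrow> k \<le> c" for k
      unfolding c_def by (blast intro: Max_in Max_ge)+
    then have c: "a \<le> c" "c < b" "M c" "\<And>k. a \<le> k \<Longrightarrow> k < b \<Longrightarrow> M k \<Longrightarrow> k \<le> c"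
      by (simp_all add: S_def)
    have none: "\<not> M k" if "c < k" "k < b" for k using c(4)[of k] c(1) that by auto
    have IH: "odd (card {i. a \<le> i \<and> i < c \<and> M i \<and> M (Suc i)}) \<longleftrightarrow> odd (c - a)"
      using c less.prems(3) by (intro less.IH less.prems(1)) auto
    have g: "odd (b - c) \<Longrightarrow> b = Suc c" 
      by (rule less.prems(1)[OF c(1,2) order_refl c(3) less.prems(4) none])
    have split: "{i. a \<le> i \<and> i < b \<and> M i \<and> M (Suc i)} =
        {i. a \<le> i \<and> i < c \<and> M i \<and> M (Suc i)} \<union> (if b = Suc c then {c} else {})"
    proof -
      have "b = Suc c" if "M (Suc c)" using none[of "Suc c"] c(2) that by (cases "b = Suc c") auto
      moreover have "i < c \<or> i = c" if "a \<le> i" "i < b" "M i" for i using c(4)[OF that] by linarith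
      ultimately show ?thesis using c less.prems(4) by (cases "b = Suc c") (simp; blast intro: less_trans)+
    qed
    have fin: "finite {i. a \<le> i \<and> i < c \<and> M i \<and> M (Suc i)}" by auto
    have "b - a = (c - a) + (b - c)" using c by simp
    then have "odd (b - a) \<longleftrightarrow> (odd (c - a) \<noteq> odd (b - c))" by (simp only: odd_add)
    moreover have "odd (b - c) \<longleftrightarrow> b = Suc c" using g by auto
    moreover have parity: "odd n \<longleftrightarrow> (odd m \<noteq> P)" if "n = m + (if P then 1 else 0)" for n m :: nat and P
      using that by simp
    have "card {i. a \<le> i \<and> i < b \<and> M i \<and> M (Suc i)} =
        card {i. a \<le> i \<and> i < c \<and> M i \<and> M (Suc i)} + (if b = Suc c then 1 else 0)"
      unfolding split using fin by simp
    from parity[OF this] have "odd (card {i. a \<le> i \<and> i < b \<and> M i \<and> M (Suc i)}) \<longleftrightarrow>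
        (odd (card {i. a \<le> i \<and> i < c \<and> M i \<and> M (Suc i)}) \<noteq> (b = Suc c))" .
    ultimately show ?thesis using IH by argo
  qed
qed

text \<open>The last two assumptions exclude the leaps and the odd antipaths
  that are the exceptional outcomes of the Roussel--Rubio lemma. What remains of it is that the
  subpaths of \<open>ps\<close> between consecutive vertices complete to an anticonnected subset of \<open>X\<close>
  have length one or even length.\<close>
locale path_and_set =
  fixes V :: "'a set" and E :: "'a \<Rightarrow> 'a \<Rightarrow> bool" and ps :: "'a list" and X T :: "'a set"
  assumes sym: "symp E" and irr: "irreflp E" and berge: "berge V E"
    and path: "ind_path V E ps" and X: "finite X" "X \<subseteq> V" "set ps \<inter> X = {}"
    and inner: "\<And>i. 0 < i \<Longrightarrow> Suc i < length ps \<Longrightarrow> ps!i \<in> T"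
    and no_odd_path: "\<And>vs. ind_path V E vs \<Longrightarrow> hd vs \<in> X \<Longrightarrow> last vs \<in> X \<Longrightarrow> \<not> E (hd vs) (last vs)
        \<Longrightarrow> set (butlast (tl vs)) \<subseteq> T \<Longrightarrow> odd (length vs)"
    and no_odd_antipath: "\<And>vs. ind_path V (co E) vs \<Longrightarrow> hd vs \<in> T \<Longrightarrow> last vs \<in> T \<Longrightarrow> E (hd vs) (last vs)
        \<Longrightarrow> set (butlast (tl vs)) \<subseteq> X \<Longrightarrow> odd (length vs)"
begin

lemmas symc = symp_co[OF sym] and irrc = irreflp_co[of E]

lemma E_sym: "E a b \<Longrightarrow> E b a" using sym by (auto dest: sympD)

section \<open>Gaps between the complete positions of a path\<close>

definition cplt :: "'a set \<Rightarrow> nat \<Rightarrow> bool" where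
  "cplt Y i \<longleftrightarrow> (\<forall>y\<in>Y. E y (ps!i))"

definition gap_ok :: "'a set \<Rightarrow> bool" where
  "gap_ok Y \<longleftrightarrow> (\<forall>i j. i < j \<and> j < length ps \<and> cplt Y i \<and> cplt Y j \<and>
     (\<forall>k. i < k \<longrightarrow> k < j \<longrightarrow> \<not> cplt Y k) \<and> odd (j - i) \<longrightarrow> j = Suc i)"

lemma gap_okD:
  "gap_ok Y \<Longrightarrow> i < j \<Longrightarrow> j < length ps \<Longrightarrow> cplt Y i \<Longrightarrow> cplt Y j \<Longrightarrow>
     (\<And>k. i < k \<Longrightarrow> k < j \<Longrightarrow> \<not> cplt Y k) \<Longrightarrow> odd (j - i) \<Longrightarrow> j = Suc i"
  unfolding gap_ok_def by blast

lemma odd_edges: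
  assumes "gap_ok Y" "cplt Y i" "cplt Y j" "i \<le> j" "j < length ps"
  shows "odd (card {k. i \<le> k \<and> k < j \<and> cplt Y k \<and> cplt Y (Suc k)}) \<longleftrightarrow> odd (j - i)"
  by (rule gap_parity) (use gap_okD[OF assms(1)] assms in auto)

definition seg :: "nat \<Rightarrow> nat \<Rightarrow> 'a list" where
  "seg i j = map ((!) ps) [i..<Suc j]"

lemma seg:
  assumes "i \<le> j" "j < length ps"
  shows "ind_path V E (seg i j)" "hd (seg i j) = ps!i" "last (seg i j) = ps!j"
    "length (seg i j) = Suc (j - i)" "set (seg i j) = (!) ps ` {i..j}"
proof -
  have "ps = take i ps @ seg i j @ drop (Suc j) ps"
    by (rule nth_equalityI) (use assms in \<open>auto simp: seg_def nth_append simp del: upt_Suc\<close>)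
  moreover have "seg i j \<noteq> []" using assms by (simp add: seg_def)
  ultimately show "ind_path V E (seg i j)" using ind_path_sub path by metis
  show "hd (seg i j) = ps!i" "last (seg i j) = ps!j"
    using assms by (simp_all add: seg_def hd_map last_map del: upt_Suc)
  show "length (seg i j) = Suc (j - i)" "set (seg i j) = (!) ps ` {i..j}"
    using assms by (auto simp: seg_def simp del: upt_Suc)
qed

lemma dist: "i < length ps \<Longrightarrow> j < length ps \<Longrightarrow> ps!i = ps!j \<longleftrightarrow> i = j"
  using path by (auto simp: ind_path_def nth_eq_iff_index_eq)

lemma ps_adj: "i < length ps \<Longrightarrow> j < length ps \<Longrightarrow> E (ps!i) (ps!j) \<longleftrightarrow> i = Suc j \<or> j = Suc i"
  using path by (auto simp: ind_path_def)

lemma ps_V: "i < length ps \<Longrightarrow> ps!i \<in> V"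
  using path by (auto simp: ind_path_def)

lemma ps_X: "i < length ps \<Longrightarrow> ps!i \<notin> X"
  using X by (auto dest: nth_mem)

lemma no_odd_hole: "hole V E vs \<Longrightarrow> even (length vs)"
  and no_odd_antihole: "hole V (co E) vs \<Longrightarrow> even (length vs)"
  using berge unfolding berge_def antihole_def by auto

text \<open>An odd gap longer than one edge has an even number of vertices and closes up with
  \<open>x\<close> to an odd hole.\<close>

lemma gap_ok_singleton:
  assumes "x \<in> X"
  shows "gap_ok {x}"
  unfolding gap_ok_def
proof (intro allI impI, rule ccontr)
  fix i j assume *: "i < j \<and> j < length ps \<and> cplt {x} i \<and> cplt {x} j \<and>
     (\<forall>k. i < k \<longrightarrow> k < j \<longrightarrow> \<not> cplt {x} k) \<and> odd (j - i)" "j \<noteq> Suc i"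
  then have ge: "j - i \<ge> 2" by linarith
  have s: "ind_path V E (seg i j)" "hd (seg i j) = ps!i" "last (seg i j) = ps!j"
    "length (seg i j) = Suc (j - i)" "set (seg i j) = (!) ps ` {i..j}"
    using seg[of i j] * by auto
  have "hole V E (x # seg i j)"
  proof (rule hole_ConsI[OF sym irr s(1)])
    show "x \<in> V" using assms X by auto
    show "x \<notin> set (seg i j)" using s * ps_X assms by auto
    fix p assume "p \<in> set (seg i j)" "E x p"
    then obtain k where "i \<le> k" "k \<le> j" "p = ps!k" "cplt {x} k" using s by (auto simp: cplt_def)
    then show "p = hd (seg i j) \<or> p = last (seg i j)"
      using s * by (metis le_neq_implies_less)
  qed (use s * ge in \<open>auto simp: cplt_def\<close>)
  then show False using no_odd_hole[of "x # seg i j"] s * by simp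
qed

text \<open>Together with \<open>x\<close> and \<open>y\<close>, the vertices from position
  \<open>i\<close> to \<open>j\<close> form an induced path with interior in \<open>T\<close>, so
  \<open>no_odd_path\<close> fixes its parity. The bounds on \<open>i\<close> and \<open>j\<close>
  keep it away from the ends of \<open>ps\<close>, which need not lie in \<open>T\<close>.\<close>

lemma leap:
  assumes "x \<in> X" "y \<in> X" "x \<noteq> y" "\<not> E x y" "0 < i" "i \<le> j" "Suc j < length ps"
    and "E x (ps!i)" "E y (ps!j)"
    and x: "\<And>k. i < k \<Longrightarrow> k \<le> j \<Longrightarrow> \<not> E x (ps!k)" and y: "\<And>k. i \<le> k \<Longrightarrow> k < j \<Longrightarrow> \<not> E y (ps!k)"
  shows "even (j - i)"
proof -
  have s: "ind_path V E (seg i j)" "hd (seg i j) = ps!i" "last (seg i j) = ps!j"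
    "length (seg i j) = Suc (j - i)" "set (seg i j) = (!) ps ` {i..j}"
    using seg[of i j] assms by auto
  then have ne: "seg i j \<noteq> []" by auto
  have notin: "z \<notin> set (seg i j)" if "z \<in> X" for z using s assms ps_X that by auto
  have 1: "ind_path V E (seg i j @ [y])"
  proof (rule ind_path_snocI[OF sym irr s(1)])
    fix u assume "u \<in> set (seg i j)" "E u y"
    then obtain k where k: "i \<le> k" "k \<le> j" "u = ps!k" "E y (ps!k)" using s E_sym by auto
    then show "u = last (seg i j)" using s y[of k] by (cases "k = j") auto
  qed (use s assms X notin E_sym in auto)
  have 2: "ind_path V E (x # seg i j @ [y])"
  proof (rule ind_path_ConsI[OF sym irr 1])
    fix w assume w: "w \<in> set (seg i j @ [y])" "E x w"
    then obtain k where k: "i \<le> k" "k \<le> j" "w = ps!k" using s assms by auto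
    then show "w = hd (seg i j @ [y])" using s ne x[of k] w by (cases "k = i") auto
  qed (use s ne assms X notin in auto)
  have "odd (length (x # seg i j @ [y]))"
  proof (rule no_odd_path[OF 2])
    show "set (butlast (tl (x # seg i j @ [y]))) \<subseteq> T"
      using s assms inner by auto
  qed (use assms in auto)
  then show ?thesis using s by simp
qed

lemma cplt_mono: "cplt Y k \<Longrightarrow> Z \<subseteq> Y \<Longrightarrow> cplt Z k"
  by (auto simp: cplt_def)

lemma cplt_remove_nonadj:
  assumes "cplt (Y - {x}) k" "\<not> cplt Y k"
  shows "\<not> E x (ps!k)"
  using assms by (auto simp: cplt_def)

lemma co_adj_remove:
  assumes "Y \<subseteq> X" "x \<in> Y" "k < length ps" "cplt (Y - {x}) k" "\<not> cplt Y k" "y \<in> Y"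
  shows "co E (ps!k) y \<longleftrightarrow> y = x"
proof
  assume "co E (ps!k) y"
  then show "y = x" using assms(4,6) E_sym by (auto simp: cplt_def co_def)
next
  assume "y = x"
  then show "co E (ps!k) y"
    using cplt_remove_nonadj[OF assms(4,5)] E_sym ps_X[OF assms(3)] assms(1,6) by (auto simp: co_def)
qed

text \<open>An antipath through \<open>Y\<close> joins the two middle vertices. It has an odd number
  of vertices by \<open>no_odd_antipath\<close>, and the two ends of the gap close it up to an odd
  antihole.\<close>

lemma no_gap_three:
  assumes "Y \<subseteq> X" "Y \<noteq> {}" "connected_in (co E) Y" "i + 3 < length ps" "cplt Y i" "cplt Y (i + 3)"
    and "\<not> cplt Y (i + 1)" "\<not> cplt Y (i + 2)"
  shows False
proof -
  let ?p = "ps!(i + 1)" and ?q = "ps!(i + 2)"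
  obtain y1 where y1: "y1 \<in> Y" "co E y1 ?p"
    using assms(1,4,7) ps_X[of "i + 1"] by (auto simp: cplt_def co_def)
  obtain y2 where y2: "y2 \<in> Y" "co E y2 ?q"
    using assms(1,4,8) ps_X[of "i + 2"] by (auto simp: cplt_def co_def)
  let ?D = "insert ?q (insert ?p Y)"
  have "connected_in (co E) ?D"
    using connected_in_insert[OF symc connected_in_insert[OF symc assms(3) y1] _ y2(2)] y2(1) by simp
  then obtain Q where Q: "ind_path ?D (co E) Q" "hd Q = ?p" "last Q = ?q"
    using connected_in_path[OF symc irrc] by (metis insertI1 insertI2)
  have DV: "?D \<subseteq> V" using assms(1,4) X ps_V by auto
  have QV: "ind_path V (co E) Q" using ind_path_mono[OF Q(1) DV] .
  have pq: "?p \<noteq> ?q" "E ?p ?q" using assms(4) by (simp_all add: dist ps_adj)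
  obtain Q' where Q': "Q = ?p # Q' @ [?q]"
  proof -
    have "Q \<noteq> []" using Q by (auto simp: ind_path_def)
    then obtain R where R: "Q = ?p # R" using Q(2) by (cases Q) auto
    then have "R \<noteq> []" using Q(3) pq by auto
    then have "R = butlast R @ [?q]" using R Q(3) by (metis append_butlast_last_id last_ConsR)
    then show thesis using that R by metis
  qed
  have setQ: "set Q \<subseteq> ?D" "distinct Q" using Q by (auto simp: ind_path_def)
  then have Q'Y: "set Q' \<subseteq> Y" unfolding Q' by auto
  have oddQ: "odd (length Q)"
    by (rule no_odd_antipath[OF QV]) (use Q Q' Q'Y pq assms inner in auto)
  have co0: "co E (ps!i) y \<longleftrightarrow> y = ?q" if "y \<in> ?D" for y
    using that assms(1,4,5) E_sym ps_X ps_adj dist by (auto simp: co_def cplt_def)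
  have co3: "co E (ps!(i+3)) y \<longleftrightarrow> y = ?p" if "y \<in> ?D" for y
    using that assms(1,4,6) E_sym ps_X ps_adj dist by (auto simp: co_def cplt_def)
  have notin: "ps!i \<notin> ?D" "ps!(i+3) \<notin> ?D" using assms(1,4) ps_X dist by auto
  have 1: "ind_path V (co E) (ps!(i+3) # Q)"
  proof (rule ind_path_ConsI[OF symc irrc QV])
    show "ps!(i+3) \<in> V" using assms ps_V by auto
    show "ps!(i+3) \<notin> set Q" using notin setQ by blast
    show "co E (ps!(i+3)) (hd Q)" using co3 Q(2) by simp
    fix w assume "w \<in> set Q" "co E (ps!(i+3)) w"
    then show "w = hd Q" using co3[of w] setQ Q(2) by auto
  qed
  have i3: "co E (ps!i) (ps!(i+3))" "ps!i \<noteq> ps!(i+3)" using assms(4) by (auto simp: co_def dist ps_adj)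
  have ne: "Q \<noteq> []" using Q' by simp
  have "hole V (co E) (ps!i # ps!(i+3) # Q)"
  proof (rule hole_ConsI[OF symc irrc 1])
    show "ps!i \<in> V" using assms ps_V by auto
    show "ps!i \<notin> set (ps!(i+3) # Q)" using notin setQ i3 by auto
    show "co E (ps!i) (last (ps!(i+3) # Q))" using co0 Q(3) ne by simp
    fix w assume "w \<in> set (ps!(i+3) # Q)" "co E (ps!i) w"
    then show "w = hd (ps!(i+3) # Q) \<or> w = last (ps!(i+3) # Q)" using co0[of w] setQ Q(3) ne by auto
  qed (use Q' i3 in auto)
  then show False using no_odd_antihole oddQ by fastforce
qed

end

text \<open>A counterexample with minimal \<open>Y\<close>: an odd gap of length at least 5, with
  \<open>sub\<close> as induction hypothesis. Length 3 is left to \<open>no_gap_three\<close>,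
  because \<open>far_pair\<close> needs the extra room.\<close>

locale minimal_gap = path_and_set +
  fixes Y :: "'a set" and i j :: nat
  assumes Y: "Y \<subseteq> X" "Y \<noteq> {}" "connected_in (co E) Y" and ij: "i + 5 \<le> j" "j < length ps"
    and ends: "cplt Y i" "cplt Y j" and none: "\<And>k. i < k \<Longrightarrow> k < j \<Longrightarrow> \<not> cplt Y k" and odd: "odd (j - i)"
    and sub: "\<And>Z. Z \<subset> Y \<Longrightarrow> Z \<noteq> {} \<Longrightarrow> connected_in (co E) Z \<Longrightarrow> gap_ok Z"
begin

lemma none_edge: "i \<le> k \<Longrightarrow> k < j \<Longrightarrow> \<not> (cplt Y k \<and> cplt Y (Suc k))"
  using none[of k] none[of "Suc k"] ij by (cases "k = i") auto

lemma sub_edges: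
  assumes "Z \<subset> Y" "Z \<noteq> {}" "connected_in (co E) Z"
  shows "odd (card {k. i \<le> k \<and> k < j \<and> cplt Z k \<and> cplt Z (Suc k)})"
  using odd_edges[OF sub[OF assms], of i j] assms(1) ends ij odd cplt_mono[of Y _ Z] by auto

lemma sub_edge:
  assumes "Z \<subset> Y" "Z \<noteq> {}" "connected_in (co E) Z"
  obtains k where "i \<le> k" "k < j" "cplt Z k" "cplt Z (Suc k)"
proof -
  have "{k. i \<le> k \<and> k < j \<and> cplt Z k \<and> cplt Z (Suc k)} \<noteq> {}"
    using sub_edges[OF assms] by (metis card.empty even_zero)
  then show thesis using that by auto
qed

text \<open>The vertex at \<open>u\<close> has \<open>x\<close> as its only nonneighbour in
  \<open>Y\<close>, and the vertex at \<open>w\<close> has \<open>y\<close>. So an antipath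
  \<open>Q\<close> from \<open>x\<close> to \<open>y\<close> extends at both ends: to an antihole if
  these two vertices are nonadjacent, to a longer antipath otherwise.\<close>

lemma antipath_close:
  assumes "x \<in> Y" "y \<in> Y" "x \<noteq> y" "ind_path Y (co E) Q" "hd Q = x" "last Q = y"
    and u: "i < u" "u < j" "cplt (Y - {x}) u" and w: "i < w" "w < j" "cplt (Y - {y}) w"
  shows "u \<noteq> w" "ind_path V (co E) (Q @ [ps!w])"
    "ps!u \<notin> set Q" "\<And>q. q \<in> set Q \<Longrightarrow> co E (ps!u) q \<longleftrightarrow> q = x"
proof -
  have lens: "u < length ps" "w < length ps" using u w ij by auto
  have "\<not> cplt Y u" "\<not> cplt Y w" using none u w by auto
  then have cu: "co E (ps!u) q \<longleftrightarrow> q = x" and cw: "co E (ps!w) q \<longleftrightarrow> q = y" if "q \<in> Y" for q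
    using co_adj_remove[of Y x u q] co_adj_remove[of Y y w q] that Y assms lens by auto
  then show "u \<noteq> w" using assms by blast
  have QY: "set Q \<subseteq> Y" using assms(4) by (auto simp: ind_path_def)
  then show "ps!u \<notin> set Q" "\<And>q. q \<in> set Q \<Longrightarrow> co E (ps!u) q \<longleftrightarrow> q = x"
    using ps_X lens Y cu by auto
  have QV: "ind_path V (co E) Q" using ind_path_mono[OF assms(4)] Y X by blast
  show "ind_path V (co E) (Q @ [ps!w])"
  proof (rule ind_path_snocI[OF symc irrc QV])
    show "ps!w \<in> V" "ps!w \<notin> set Q" using lens ps_V ps_X QY Y by auto
    show "co E (last Q) (ps!w)" using cw[of y] assms sympD[OF symc] by auto
    fix q assume "q \<in> set Q" "co E q (ps!w)"
    then show "q = last Q" using cw[of q] QY assms(6) sympD[OF symc] by auto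
  qed
qed

text \<open>Each of \<open>Y - {x}\<close> and \<open>Y - {y}\<close> has a complete edge in the
  gap. The two edges are disjoint, since an inner vertex of the gap complete to both sets would be
  complete to \<open>Y\<close>.\<close>

lemma far_pair:
  assumes "x \<in> Y" "y \<in> Y" "x \<noteq> y" "connected_in (co E) (Y - {x})" "connected_in (co E) (Y - {y})"
  obtains u w where "i < u" "u < j" "cplt (Y - {x}) u" "i < w" "w < j" "cplt (Y - {y}) w"
    "u + 2 \<le> w \<or> w + 2 \<le> u"
proof -
  have sx: "Y - {x} \<subset> Y" "Y - {x} \<noteq> {}" and sy: "Y - {y} \<subset> Y" "Y - {y} \<noteq> {}" using assms by auto
  obtain a where a: "i \<le> a" "a < j" "cplt (Y - {x}) a" "cplt (Y - {x}) (Suc a)"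
    using sub_edge[OF sx assms(4)] by blast
  obtain b where b: "i \<le> b" "b < j" "cplt (Y - {y}) b" "cplt (Y - {y}) (Suc b)"
    using sub_edge[OF sy assms(5)] by blast
  have disj: "k \<noteq> l" if "i < k" "k < j" "cplt (Y - {x}) k" "cplt (Y - {y}) l" for k l
  proof
    assume "k = l"
    then have "cplt Y k" using that assms(1-3) unfolding cplt_def by (metis Diff_iff singletonD)
    then show False using none that by blast
  qed
  \<comment> \<open>One end is chosen from each edge. Only if the edges sit at both extremes of the
    gap must their inner ends be taken, and then the length of at least 5 keeps these apart.\<close>
  have *: "\<exists>u w. i < u \<and> u < j \<and> i < w \<and> w < j \<and> u + 2 \<le> w \<and> (u = a \<or> u = Suc a) \<and> (w = b \<or> w = Suc b)"
    if "i \<le> a" "Suc a < b" "b < j" for a b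
  proof -
    have "i < a \<or> Suc b < j \<or> Suc a + 2 \<le> b" using that ij by linarith
    then show ?thesis
    proof (elim disjE)
      assume "i < a"
      then show ?thesis using that by (intro exI[of _ a] exI[of _ b]) auto
    next
      assume "Suc b < j"
      then show ?thesis using that by (intro exI[of _ "Suc a"] exI[of _ "Suc b"]) auto
    next
      assume "Suc a + 2 \<le> b"
      then show ?thesis using that by (intro exI[of _ "Suc a"] exI[of _ b]) auto
    qed
  qed
  have "a \<noteq> b"
  proof
    assume "a = b"
    then show False using disj[of a b] disj[of "Suc a" "Suc b"] a b ij by (cases "a = i") auto
  qed
  moreover have "Suc a \<noteq> b"
    using disj[of "Suc a" b] a b by auto
  moreover have "Suc b \<noteq> a"
    using disj[of a "Suc b"] a b by auto
  ultimately have "Suc a < b \<or> Suc b < a" by linarith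
  then show thesis
  proof
    assume "Suc a < b"
    then obtain u w where "i < u" "u < j" "i < w" "w < j" "u + 2 \<le> w" "u = a \<or> u = Suc a" "w = b \<or> w = Suc b"
      using *[of a b] a b by blast
    then show thesis using that[of u w] a b by blast
  next
    assume "Suc b < a"
    then obtain u w where "i < u" "u < j" "i < w" "w < j" "u + 2 \<le> w" "u = b \<or> u = Suc b" "w = a \<or> w = Suc a"
      using *[of b a] a b by blast
    then show thesis using that[of w u] a b by blast
  qed
qed

text \<open>The antipath closes up through the two vertices of \<open>far_pair\<close>, which are
  nonadjacent, to an antihole with two more vertices.\<close>

lemma even_antipath:
  assumes "x \<in> Y" "y \<in> Y" "x \<noteq> y" "connected_in (co E) (Y - {x})" "connected_in (co E) (Y - {y})"
    and "ind_path Y (co E) Q" "hd Q = x" "last Q = y"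
  shows "even (length Q)"
proof -
  obtain u w where uw: "i < u" "u < j" "cplt (Y - {x}) u" "i < w" "w < j" "cplt (Y - {y}) w"
      "u + 2 \<le> w \<or> w + 2 \<le> u"
    using far_pair[OF assms(1-5)] .
  note c = antipath_close[OF assms(1-3,6-8) uw(1-6)]
  have lens: "u < length ps" "w < length ps" using uw ij by auto
  have ne: "Q \<noteq> []" using assms(6) by (auto simp: ind_path_def)
  have "length Q \<noteq> 1" using assms(3,7,8) by (auto simp: length_Suc_conv)
  then have len: "length Q \<ge> 2" using ne by (cases Q; cases "tl Q") auto
  have "hole V (co E) (ps!u # (Q @ [ps!w]))"
  proof (rule hole_ConsI[OF symc irrc c(2)])
    show "ps!u \<in> V" "ps!u \<notin> set (Q @ [ps!w])" using lens ps_V c dist by auto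
    show "co E (ps!u) (hd (Q @ [ps!w]))" using c(4)[of x] ne assms(7) by (auto simp: hd_append)
    show "co E (ps!u) (last (Q @ [ps!w]))" using uw lens dist ps_adj by (auto simp: co_def)
    fix p assume "p \<in> set (Q @ [ps!w])" "co E (ps!u) p"
    then show "p = hd (Q @ [ps!w]) \<or> p = last (Q @ [ps!w])"
      using c(4)[of p] ne assms(7) by (auto simp: hd_append)
  qed (use len in auto)
  then show ?thesis using no_odd_antihole by fastforce
qed

text \<open>With adjacent ends the extended antipath falls under \<open>no_odd_antipath\<close>,
  which contradicts the parity found in \<open>even_antipath\<close>.\<close>

lemma no_adjacent_pair:
  assumes "x \<in> Y" "y \<in> Y" "x \<noteq> y" "connected_in (co E) (Y - {x})" "connected_in (co E) (Y - {y})"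
    and u: "i < u" "u < j" "cplt (Y - {x}) u" and w: "i < w" "w < j" "cplt (Y - {y}) w"
  shows "\<not> (u = Suc w \<or> w = Suc u)"
proof
  assume adj: "u = Suc w \<or> w = Suc u"
  obtain Q where Q: "ind_path Y (co E) Q" "hd Q = x" "last Q = y"
    using connected_in_path[OF symc irrc Y(3) assms(1,2)] by blast
  note c = antipath_close[OF assms(1-3) Q u w]
  have lens: "u < length ps" "w < length ps" using u w ij by auto
  have ne: "Q \<noteq> []" "set Q \<subseteq> Y" using Q(1) by (auto simp: ind_path_def)
  have uw: "E (ps!u) (ps!w)" using lens adj by (simp add: ps_adj)
  have path: "ind_path V (co E) (ps!u # (Q @ [ps!w]))"
  proof (rule ind_path_ConsI[OF symc irrc c(2)])
    show "ps!u \<in> V" "ps!u \<notin> set (Q @ [ps!w])" using lens ps_V c dist by auto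
    show "co E (ps!u) (hd (Q @ [ps!w]))" using c(4)[of x] ne Q(2) by (auto simp: hd_append)
    fix p assume "p \<in> set (Q @ [ps!w])" "co E (ps!u) p"
    then show "p = hd (Q @ [ps!w])"
      using c(4)[of p] ne Q(2) uw by (auto simp: hd_append co_def)
  qed
  have "odd (length (ps!u # (Q @ [ps!w])))"
    by (rule no_odd_antipath[OF path]) (use u w ij inner uw ne Y in auto)
  moreover have "even (length Q)" by (rule even_antipath[OF assms(1-5) Q])
  ultimately show False by simp
qed

text \<open>Mark the vertices complete to \<open>Y - {x}\<close> or to \<open>Y - {y}\<close>. All odd gaps between marks are edges
  of one of the two kinds; by induction there is an odd number of each kind, but their total
  has the parity of \<open>j - i\<close>.\<close>
lemma no_cut_pair:
  assumes xy: "x \<in> Y" "y \<in> Y" "x \<noteq> y" "E x y"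
    and conn: "connected_in (co E) (Y - {x})" "connected_in (co E) (Y - {y})"
    and Z: "Y - {x, y} \<noteq> {}" "connected_in (co E) (Y - {x, y})"
  shows False
proof -
  let ?X = "Y - {x}" and ?Y = "Y - {y}" and ?Z = "Y - {x, y}"
  have sub': "?X \<subset> Y" "?X \<noteq> {}" "?Y \<subset> Y" "?Y \<noteq> {}" "?Z \<subset> Y" using xy by auto
  obtain Q where Q: "ind_path Y (co E) Q" "hd Q = x" "last Q = y"
    using connected_in_path[OF symc irrc Y(3) xy(1,2)] by blast
  have evenQ: "even (length Q)" by (rule even_antipath[OF xy(1-3) conn Q])
  have QV: "ind_path V (co E) Q" using ind_path_mono[OF Q(1)] Y X by blast
  have ne: "Q \<noteq> []" "set Q \<subseteq> Y" using Q(1) by (auto simp: ind_path_def)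
  have "length Q \<ge> 3"
  proof -
    have "length Q \<noteq> 1" using xy(3) Q(2,3) by (auto simp: length_Suc_conv)
    moreover have "length Q \<noteq> 2"
    proof
      assume "length Q = 2"
      then have "Q = [x, y]" using Q(2,3) by (auto simp: length_Suc_conv numeral_2_eq_2)
      then have "co E x y" using ind_path_adj[OF Q(1), of 0 1] by simp
      then show False using xy(4) by (simp add: co_def)
    qed
    ultimately show ?thesis using ne by (cases "length Q") auto
  qed
  note lenQ = this
  define M where "M k \<longleftrightarrow> cplt ?X k \<or> cplt ?Y k" for k
  \<comment> \<open>Otherwise the only nonneighbours of this vertex in \<open>Y\<close> are
    \<open>x\<close> and \<open>y\<close>, and it closes \<open>Q\<close>, which has an even number
    of vertices, to an odd antihole.\<close>
  have ZM: "M s" if s: "i < s" "s < j" "cplt ?Z s" for s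
  proof (rule ccontr)
    assume nM: "\<not> M s"
    then have nxy: "\<not> E x (ps!s)" "\<not> E y (ps!s)" using s(3) xy unfolding M_def cplt_def by blast+
    have len: "s < length ps" using s ij by simp
    then have nin: "ps!s \<notin> Y" using ps_X Y by auto
    have cs: "co E (ps!s) q \<longleftrightarrow> q = x \<or> q = y" if "q \<in> Y" for q
      using that s(3) nxy nin E_sym xy unfolding cplt_def co_def by blast
    have "hole V (co E) (ps!s # Q)"
      by (rule hole_ConsI[OF symc irrc QV lenQ]) (use len ps_V nin ne cs Q xy in auto)
    then show False using no_odd_antihole evenQ by fastforce
  qed
  have odd_gap: "b = Suc a" if ab: "i \<le> a" "a < b" "b \<le> j" "M a" "M b"
      and noM: "\<And>k. a < k \<Longrightarrow> k < b \<Longrightarrow> \<not> M k" and odd': "odd (b - a)" for a b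
  proof -
    have lb: "b < length ps" using ab ij by simp
    have nX: "\<not> cplt ?X k" "\<not> cplt ?Y k" if "a < k" "k < b" for k using noM[OF that] by (auto simp: M_def)
    \<comment> \<open>Marks of the same kind fall to the induction hypothesis for that set. Marks of
      different kinds are both complete to \<open>Y - {x, y}\<close>, and by \<open>ZM\<close> no
      position between them is, so the hypothesis for this smaller set applies.\<close>
    consider "cplt ?X a" "cplt ?X b" | "cplt ?Y a" "cplt ?Y b" 
      | "a \<noteq> i" "b \<noteq> j" "cplt ?Z a" "cplt ?Z b"
    proof -
      have "cplt ?X i" "cplt ?X j" "cplt ?Y i" "cplt ?Y j" using ends by (auto simp: cplt_def)
      moreover have "cplt ?Z a" "cplt ?Z b" using ab unfolding M_def cplt_def by blast+
      ultimately show thesis using that ab(4,5) unfolding M_def by blast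
    qed
    then show ?thesis
    proof cases
      case 1
      show ?thesis by (rule gap_okD[OF sub[OF sub'(1,2) conn(1)] ab(2) lb 1 _ odd']) (use nX in blast)
    next
      case 2
      show ?thesis by (rule gap_okD[OF sub[OF sub'(3,4) conn(2)] ab(2) lb 2 _ odd']) (use nX in blast)
    next
      case 3
      show ?thesis
        by (rule gap_okD[OF sub[OF sub'(5) Z] ab(2) lb 3(3,4) _ odd']) (use noM ZM ab in force)
    qed
  qed
  have "odd (card {k. i \<le> k \<and> k < j \<and> M k \<and> M (Suc k)}) \<longleftrightarrow> odd (j - i)"
  proof (rule gap_parity[OF odd_gap])
    show "i \<le> j" "M i" "M j" using ij ends by (auto simp: M_def cplt_def)
  qed
  moreover have "{k. i \<le> k \<and> k < j \<and> M k \<and> M (Suc k)} =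
      {k. i \<le> k \<and> k < j \<and> cplt ?X k \<and> cplt ?X (Suc k)} \<union> {k. i \<le> k \<and> k < j \<and> cplt ?Y k \<and> cplt ?Y (Suc k)}"
    (is "?L = ?A \<union> ?B")
  proof -
    have iff: "cplt ?X l" "cplt ?Y l" if "l = i \<or> l = j" for l using that ends by (auto simp: cplt_def)
    \<comment> \<open>An edge with only mixed marks would lie strictly inside the gap, which
      \<open>no_adjacent_pair\<close> excludes.\<close>
    have "k \<in> ?A \<union> ?B" if "k \<in> ?L" for k
    proof (rule ccontr)
      assume "k \<notin> ?A \<union> ?B"
      with that have k: "i \<le> k" "k < j" and mix: "(cplt ?X k \<and> cplt ?Y (Suc k)) \<or> (cplt ?Y k \<and> cplt ?X (Suc k))"
        and nX: "\<not> (cplt ?X k \<and> cplt ?X (Suc k))" "\<not> (cplt ?Y k \<and> cplt ?Y (Suc k))"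
        by (auto simp: M_def)
      have "k \<noteq> i" "Suc k \<noteq> j" using mix nX iff by blast+
      then have "i < k" "Suc k < j" "i < Suc k" using k by auto
      then show False
        using mix no_adjacent_pair[OF xy(1-3) conn, of k "Suc k"] no_adjacent_pair[OF xy(1-3) conn, of "Suc k" k] k
        by blast
    qed
    then show ?thesis by (auto simp: M_def)
  qed
  \<comment> \<open>A vertex complete to both \<open>Y - {x}\<close> and \<open>Y - {y}\<close> is
    complete to \<open>Y\<close>, and the gap contains no edge of such vertices.\<close>
  moreover have "?A \<inter> ?B = {}"
  proof -
    have "cplt Y k" if "cplt ?X k" "cplt ?Y k" for k using that xy unfolding cplt_def by blast
    then show ?thesis using none_edge by blast
  qed
  moreover have "finite ?A" "finite ?B" by auto
  ultimately have "odd (card ?A + card ?B)"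
    using odd by (simp add: card_Un_disjoint)
  then show False using sub_edges[OF sub'(1,2) conn(1)] sub_edges[OF sub'(3,4) conn(2)] by simp
qed

text \<open>For stable \<open>Y\<close>, the parity of \<open>j - i\<close> is that of the number of edges with a common neighbour in
  \<open>Y\<close>, which modulo 2 is the sum over all nonempty \<open>Z \<subseteq> Y\<close> of the number of \<open>Z\<close>-complete edges. By
  induction the \<open>2 ^ card Y - 2\<close> proper subsets contribute an odd number each.\<close>
lemma not_stable:
  assumes stable: "\<And>x y. x \<in> Y \<Longrightarrow> y \<in> Y \<Longrightarrow> \<not> E x y" and two: "card Y \<ge> 2"
  shows False
proof -
  have finY: "finite Y" using X Y finite_subset by blast
  have conn: "connected_in (co E) Z" if "Z \<subseteq> Y" for Z
  proof (subst connected_in_iff[OF symc], intro allI impI)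
    fix P assume "P \<subseteq> Z" "P \<noteq> {} \<and> P \<noteq> Z"
    then obtain p q where "p \<in> P" "q \<in> Z - P" by blast
    moreover from this have "co E p q" using stable[of p q] \<open>P \<subseteq> Z\<close> that by (auto simp: co_def)
    ultimately show "\<exists>p\<in>P. \<exists>q\<in>Z-P. co E p q" by blast
  qed
  define M where "M k \<longleftrightarrow> (\<exists>y\<in>Y. E y (ps!k))" for k
  define N where "N k = {y\<in>Y. E y (ps!k) \<and> E y (ps!Suc k)}" for k
  have finN: "finite (N k)" for k using finY by (simp add: N_def)
  \<comment> \<open>Two marks with a common neighbour in \<open>Y\<close> are covered by the
    singleton case. Otherwise distinct nonadjacent \<open>x\<close> and \<open>y\<close> attach to
    the two marks, neither of which is an end of the whole gap, and \<open>leap\<close>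
    applies.\<close>
  have gap: "even (b - a) \<or> (\<exists>y\<in>Y. E y (ps!a) \<and> E y (ps!b)) \<and> b = Suc a"
    if ab: "i \<le> a" "a < b" "b \<le> j" "M a" "M b" and noM: "\<And>k. a < k \<Longrightarrow> k < b \<Longrightarrow> \<not> M k" for a b
  proof (cases "\<exists>y\<in>Y. E y (ps!a) \<and> E y (ps!b)")
    case True
    then obtain y where y: "y \<in> Y" "E y (ps!a)" "E y (ps!b)" by blast
    have "gap_ok {y}" using gap_ok_singleton y Y by blast
    then have "odd (b - a) \<Longrightarrow> b = Suc a"
      by (rule gap_okD) (use ab ij y noM in \<open>auto simp: cplt_def M_def\<close>)
    then show ?thesis using True by blast
  next
    case False
    obtain x y where xy: "x \<in> Y" "y \<in> Y" "E x (ps!a)" "E y (ps!b)" using ab unfolding M_def by blast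
    then have "x \<noteq> y" using False by blast
    have "a \<noteq> i" "b \<noteq> j" using False xy ends by (auto simp: cplt_def)
    then have "0 < a" "Suc b < length ps" using ab ij by auto
    have "even (b - a)"
    proof (rule leap[of x y a b])
      show "x \<in> X" "y \<in> X" using xy Y by auto
      fix k assume "a < k" "k \<le> b"
      then show "\<not> E x (ps!k)" using noM[of k] False xy by (cases "k = b") (auto simp: M_def)
    next
      fix k assume "a \<le> k" "k < b"
      then show "\<not> E y (ps!k)" using noM[of k] False xy by (cases "k = a") (auto simp: M_def)
    qed (use xy \<open>x \<noteq> y\<close> stable ab \<open>0 < a\<close> \<open>Suc b < length ps\<close> in auto)
    then show ?thesis ..
  qed
  let ?I = "{i..<j}"
  have "odd (card {k. i \<le> k \<and> k < j \<and> M k \<and> M (Suc k)}) \<longleftrightarrow> odd (j - i)"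
  proof (rule gap_parity)
    show "i \<le> j" "M i" "M j" using ij ends Y(2) by (auto simp: M_def cplt_def)
  qed (use gap in blast)
  moreover have "{k. i \<le> k \<and> k < j \<and> M k \<and> M (Suc k)} = {k\<in>?I. N k \<noteq> {}}"
  proof -
    have "N k \<noteq> {}" if "i \<le> k" "k < j" "M k" "M (Suc k)" for k
      using gap[of k "Suc k"] that by (auto simp: N_def)
    then show ?thesis by (auto simp: N_def M_def)
  qed
  ultimately have oddN: "odd (card {k\<in>?I. N k \<noteq> {}})" using odd by simp
  define cnt where "cnt Z = card {k\<in>?I. Z \<subseteq> N k}" for Z
  have cnt_eq: "cnt Z = card {k. i \<le> k \<and> k < j \<and> cplt Z k \<and> cplt Z (Suc k)}" if "Z \<subseteq> Y" for Z
    unfolding cnt_def by (rule arg_cong[of _ _ card]) (use that in \<open>auto simp: N_def cplt_def\<close>)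
  have cnt: "odd (cnt Z)" if "Z \<in> Pow Y - {{}, Y}" for Z
    using sub_edges[of Z] conn[of Z] cnt_eq[of Z] that by auto
  have "{k. i \<le> k \<and> k < j \<and> cplt Y k \<and> cplt Y (Suc k)} = {}" using none_edge by blast
  then have cntY: "cnt Y = 0" using cnt_eq[of Y] by simp
  let ?F = "Pow Y - {{}}"
  have finF: "finite ?F" using finY by simp
  \<comment> \<open>Pairs of a nonempty \<open>Z\<close> and an edge complete to \<open>Z\<close>
    are counted in two ways. The edge at \<open>k\<close> is counted
    \<open>2 ^ card (N k) - 1\<close> times, which is odd exactly if \<open>N k\<close> is
    nonempty.\<close>
  have "(\<Sum>Z\<in>?F. cnt Z) = (\<Sum>Z\<in>?F. \<Sum>k\<in>?I. if Z \<subseteq> N k then 1 else 0)"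
    unfolding cnt_def by (simp add: sum.If_cases Int_def)
  also have "\<dots> = (\<Sum>k\<in>?I. \<Sum>Z\<in>?F. if Z \<subseteq> N k then 1 else 0)" by (rule sum.swap)
  also have "\<dots> = (\<Sum>k\<in>?I. 2 ^ card (N k) - 1)"
  proof (rule sum.cong[OF refl])
    fix k
    have "(\<Sum>Z\<in>?F. if Z \<subseteq> N k then 1 else 0) = card (?F \<inter> {Z. Z \<subseteq> N k})"
      using finF by (simp add: sum.If_cases)
    also have "?F \<inter> {Z. Z \<subseteq> N k} = Pow (N k) - {{}}" by (auto simp: N_def)
    also have "card \<dots> = 2 ^ card (N k) - 1" using finN by (simp add: card_Pow)
    finally show "(\<Sum>Z\<in>?F. if Z \<subseteq> N k then 1 else 0) = (2 ^ card (N k) - 1 :: nat)" .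
  qed
  finally have eq: "(\<Sum>Z\<in>?F. cnt Z) = (\<Sum>k\<in>?I. 2 ^ card (N k) - 1)" .
  have "even (\<Sum>Z\<in>?F. cnt Z) \<longleftrightarrow> even (card {Z\<in>?F. odd (cnt Z)})"
    using finF by (rule even_sum_iff)
  moreover have "{Z\<in>?F. odd (cnt Z)} = Pow Y - {{}, Y}" using cnt cntY by auto
  moreover have "card (Pow Y - {{}, Y}) = 2 ^ card Y - 2"
    using finY Y(2) by (simp add: card_Diff_subset card_Pow)
  moreover have "even (2 ^ card Y - 2 :: nat)" using two by simp
  moreover have "even (\<Sum>k\<in>?I. 2 ^ card (N k) - 1 :: nat) \<longleftrightarrow> even (card {k\<in>?I. odd (2 ^ card (N k) - 1 :: nat)})"
    by (rule even_sum_iff) simp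
  moreover have "odd (2 ^ card (N k) - 1 :: nat) \<longleftrightarrow> N k \<noteq> {}" for k
    using finN[of k] by (cases "N k = {}") auto
  ultimately show False using eq oddN by simp
qed

text \<open>If the complement graph on \<open>Y\<close> has a cut vertex,
  \<open>cut_vertex_ends\<close> feeds \<open>no_cut_pair\<close>. If not, every single vertex is
  removable, and an antipath on three vertices, which exists since \<open>Y\<close> is not stable,
  violates \<open>even_antipath\<close>.\<close>

lemma contradiction: "card Y \<ge> 2 \<Longrightarrow> False"
proof -
  assume two: "card Y \<ge> 2"
  have finY: "finite Y" using X Y finite_subset by blast
  obtain a b where ab: "a \<in> Y" "b \<in> Y" "E a b"
    using not_stable two by blast
  show False
  proof (cases "\<exists>c\<in>Y. \<not> connected_in (co E) (Y - {c})")
    case True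
    then obtain c where c: "c \<in> Y" "\<not> connected_in (co E) (Y - {c})" by blast
    obtain x y where xy: "x \<in> Y" "y \<in> Y" "x \<noteq> y" "\<not> co E x y" "c \<noteq> x" "c \<noteq> y"
      "connected_in (co E) (Y - {x})" "connected_in (co E) (Y - {y})" "connected_in (co E) (Y - {x, y})"
      by (rule cut_vertex_ends[OF symc finY Y(3) c])
    show False
      by (rule no_cut_pair[OF xy(1-3) _ xy(7,8) _ xy(9)]) (use xy c in \<open>auto simp: co_def\<close>)
  next
    case False
    have "a \<noteq> b" using ab irr by (auto dest: irreflpD)
    then obtain x c y where xcy: "x \<in> Y" "c \<in> Y" "y \<in> Y" "x \<noteq> c" "c \<noteq> y" "x \<noteq> y"
        "co E x c" "co E c y" "\<not> co E x y"
      using distance_two[OF symc Y(3) ab(1,2)] ab(3) by (metis co_def)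
    have "ind_path Y (co E) [x, c, y]"
    proof (rule ind_path_ConsI[OF symc irrc])
      show "ind_path Y (co E) [c, y]"
        by (rule ind_path_ConsI[OF symc irrc]) (use xcy in \<open>auto simp: co_def\<close>)
    qed (use xcy in auto)
    then have "even (length [x, c, y])"
      using even_antipath[of x y "[x, c, y]"] xcy False by auto
    then show False by simp
  qed
qed

end

context path_and_set
begin

text \<open>Induction on the size of \<open>Y\<close>: a bad gap of a singleton gives an odd hole,
  gaps of length 3 are excluded directly, and a longer bad gap yields an instance of
  \<open>minimal_gap\<close>.\<close>

theorem gap_ok_anticonnected:
  assumes "Y \<subseteq> X" "Y \<noteq> {}" "connected_in (co E) Y"
  shows "gap_ok Y"
  using assms
proof (induction "card Y" arbitrary: Y rule: less_induct)
  case less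
  have finY: "finite Y" using X less.prems finite_subset by blast
  show ?case
  proof (cases "card Y = 1")
    case True
    then show ?thesis using gap_ok_singleton less.prems by (metis card_1_singletonE insert_subset)
  next
    case False
    then have two: "card Y \<ge> 2" using less.prems finY by (cases "card Y") auto
    have sub: "gap_ok Z" if "Z \<subset> Y" "Z \<noteq> {}" "connected_in (co E) Z" for Z
      using less.hyps[of Z] that less.prems(1) psubset_card_mono[OF finY] by blast
    show ?thesis
      unfolding gap_ok_def
    proof (intro allI impI, rule ccontr)
      fix i j assume *: "i < j \<and> j < length ps \<and> cplt Y i \<and> cplt Y j \<and>
        (\<forall>k. i < k \<longrightarrow> k < j \<longrightarrow> \<not> cplt Y k) \<and> odd (j - i)" "j \<noteq> Suc i"
      then obtain m where m: "j = i + m" "odd m" "m \<noteq> 1" by (metis add.commute le_add_diff_inverse less_imp_le_nat plus_1_eq_Suc)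
      from m(2,3) have "m \<ge> 3" by presburger
      show False
      proof (cases "m = 3")
        case True
        then show False using no_gap_three[OF less.prems, of i] * m by auto
      next
        case False
        with m(2,3) have "m \<ge> 5" by presburger
        interpret minimal_gap V E ps X T Y i j
        proof unfold_locales
          show "i + 5 \<le> j" using m \<open>m \<ge> 5\<close> by simp
          show "cplt Y i" "cplt Y j" "j < length ps" "odd (j - i)" using * by blast+
          show "\<not> cplt Y k" if "i < k" "k < j" for k using * that by blast
        qed (use less.prems sub in blast)+
        show False using contradiction[OF two] .
      qed
    qed
  qed
qed

end

section \<open>Colourings and the perfect graph theorem\<close>

definition colourable :: "('a \<Rightarrow> 'a \<Rightarrow> bool) \<Rightarrow> 'a set \<Rightarrow> nat \<Rightarrow> bool" where
  "colourable E X k \<longleftrightarrow> (\<exists>c :: 'a \<Rightarrow> nat. (\<forall>x\<in>X. c x < k) \<and> (\<forall>x\<in>X. \<forall>y\<in>X. E x y \<longrightarrow> c x \<noteq> c y))"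

definition cliques_le :: "('a \<Rightarrow> 'a \<Rightarrow> bool) \<Rightarrow> 'a set \<Rightarrow> nat \<Rightarrow> bool" where
  "cliques_le E X k \<longleftrightarrow> (\<forall>K\<subseteq>X. clique E K \<longrightarrow> card K \<le> k)"

text \<open>Perfection phrased with upper bounds instead of the two optimal numbers, so that no
  maximum or least value has to be evaluated; \<open>perfect_iff_hperfect\<close> gives the
  equivalence.\<close>

definition hperfect :: "'a set \<Rightarrow> ('a \<Rightarrow> 'a \<Rightarrow> bool) \<Rightarrow> bool" where
  "hperfect V E \<longleftrightarrow> (\<forall>X\<subseteq>V. \<forall>k. cliques_le E X k \<longrightarrow> colourable E X k)"

lemma colourable_mono: "colourable E X k \<Longrightarrow> k \<le> l \<Longrightarrow> colourable E X l"
  unfolding colourable_def by (meson less_le_trans)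

lemma clique_card_le_colours:
  assumes "\<forall>x\<in>X. c x < (k::nat)" "\<forall>x\<in>X. \<forall>y\<in>X. E x y \<longrightarrow> c x \<noteq> c y" "K \<subseteq> X" "clique E K"
  shows "card K \<le> k"
proof -
  have "inj_on c K" using assms unfolding inj_on_def clique_def by blast
  then have "card K = card (c ` K)" by (simp add: card_image)
  also have "\<dots> \<le> card {..<k}" using assms by (intro card_mono) auto
  finally show ?thesis by simp
qed

lemma clique_number:
  assumes "finite X"
  shows "cliques_le E X k \<longleftrightarrow> clique_number E X \<le> k"
proof -
  let ?S = "{card K | K. K \<subseteq> X \<and> clique E K}"
  have eq: "?S = card ` {K. K \<subseteq> X \<and> clique E K}" by auto
  have "finite ?S" unfolding eq using assms by auto
  moreover have "0 \<in> ?S" by (rule CollectI, rule exI[of _ "{}"]) (simp add: clique_def)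
  then have "?S \<noteq> {}" by blast
  ultimately show ?thesis
    unfolding cliques_le_def clique_number_def by (subst Max_le_iff) auto
qed

lemma colourable_card:
  assumes "finite X" "irreflp E"
  shows "colourable E X (card X)"
proof -
  obtain c where c: "bij_betw c X {0..<card X}" using assms ex_bij_betw_finite_nat by blast
  have "c x < card X" if "x \<in> X" for x using c that by (auto simp: bij_betw_def)
  moreover have "c x \<noteq> c y" if "x \<in> X" "y \<in> X" "E x y" for x y
    using c that assms(2) by (auto simp: bij_betw_def inj_on_def dest: irreflpD)
  ultimately show ?thesis unfolding colourable_def by blast
qed

lemma colourable_iff_chromatic:
  assumes "finite X" "irreflp E"
  shows "colourable E X k \<longleftrightarrow> chromatic_number E X \<le> k"
proof -
  have chi: "chromatic_number E X = (LEAST k. colourable E X k)"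
    unfolding chromatic_number_def colourable_def ..
  have "colourable E X (chromatic_number E X)"
    unfolding chi using colourable_card[OF assms] by (rule LeastI)
  then show ?thesis using colourable_mono Least_le[of "colourable E X" k] chi by metis
qed

lemma perfect_iff_hperfect:
  assumes "finite V" "irreflp E"
  shows "perfect V E \<longleftrightarrow> hperfect V E"
proof -
  have "chromatic_number E X = clique_number E X \<longleftrightarrow> (\<forall>k. cliques_le E X k \<longrightarrow> colourable E X k)"
    if "X \<subseteq> V" for X
  proof -
    have fin: "finite X" using assms that finite_subset by blast
    have "clique_number E X \<le> chromatic_number E X"
    proof -
      obtain c where "\<forall>x\<in>X. c x < chromatic_number E X" "\<forall>x\<in>X. \<forall>y\<in>X. E x y \<longrightarrow> c x \<noteq> c y"
        using colourable_iff_chromatic[OF fin assms(2), of "chromatic_number E X"]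
        unfolding colourable_def by auto
      then show ?thesis
        using clique_card_le_colours clique_number[OF fin] unfolding cliques_le_def by metis
    qed
    then show ?thesis
      using colourable_iff_chromatic[OF fin assms(2)] clique_number[OF fin, of E] by fastforce
  qed
  then show ?thesis unfolding perfect_def hperfect_def by (rule all_cong)
qed

text \<open>Lovasz's replication lemma, phrased with vertex weights instead of copies of vertices.\<close>
lemma weighted_colouring:
  fixes w :: "'a \<Rightarrow> nat"
  assumes "finite V" "hperfect V E" "irreflp E"
    and "\<And>K. K \<subseteq> V \<Longrightarrow> clique E K \<Longrightarrow> sum w K \<le> k"
  shows "\<exists>c :: 'a \<Rightarrow> nat set. (\<forall>x\<in>V. c x \<subseteq> {..<k} \<and> card (c x) = w x) \<and>
      (\<forall>x\<in>V. \<forall>y\<in>V. E x y \<longrightarrow> c x \<inter> c y = {})"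
  using assms(4)
proof (induction "sum w V" arbitrary: w k rule: less_induct)
  case less
  show ?case
  proof (cases "\<exists>x0\<in>V. w x0 \<ge> 2")
    case False
    let ?X = "{x\<in>V. w x = 1}"
    have w01: "w x = 0 \<or> w x = 1" if "x \<in> V" for x using False that by (auto simp: not_le less_2_cases_iff)
    have "cliques_le E ?X k"
      unfolding cliques_le_def
    proof (intro allI impI)
      fix K assume K: "K \<subseteq> ?X" "clique E K"
      then have "sum w K = card K" by (subst card_eq_sum) (intro sum.cong, auto)
      then show "card K \<le> k" using less.prems[of K] K by auto
    qed
    then have "colourable E ?X k" using assms(2) unfolding hperfect_def by auto
    then obtain c where c: "\<forall>x\<in>?X. c x < k" "\<forall>x\<in>?X. \<forall>y\<in>?X. E x y \<longrightarrow> c x \<noteq> c y"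
      unfolding colourable_def by blast
    show ?thesis
      by (rule exI[of _ "\<lambda>x. if w x = 1 then {c x} else {}"]) (use c w01 in auto)
  next
    case True
    then obtain x0 where x0: "x0 \<in> V" "w x0 \<ge> 2" by blast
    \<comment> \<open>Since \<open>w x0\<close> is at least 2, \<open>x0\<close> keeps a positive
      weight, so the colouring \<open>c1\<close> still gives it some colour
      \<open>l\<close>.\<close>
    let ?w = "w(x0 := w x0 - 1)"
    have le: "sum ?w K \<le> sum w K" for K by (rule sum_mono) auto
    have "sum ?w V < sum w V"
      by (rule sum_strict_mono_ex1) (use x0 assms(1) in auto)
    moreover have "sum ?w K \<le> k" if "K \<subseteq> V" "clique E K" for K
      using le[of K] less.prems[OF that] by linarith
    ultimately have "\<exists>c. (\<forall>x\<in>V. c x \<subseteq> {..<k} \<and> card (c x) = ?w x) \<and> (\<forall>x\<in>V. \<forall>y\<in>V. E x y \<longrightarrow> c x \<inter> c y = {})"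
      by (rule less.hyps)
    then obtain c1 where c1: "\<forall>x\<in>V. c1 x \<subseteq> {..<k} \<and> card (c1 x) = ?w x"
        "\<forall>x\<in>V. \<forall>y\<in>V. E x y \<longrightarrow> c1 x \<inter> c1 y = {}"
      by blast
    have "c1 x0 \<noteq> {}"
    proof
      assume "c1 x0 = {}"
      then show False using bspec[OF c1(1) x0(1)] x0(2) by simp
    qed
    then obtain l where l: "l \<in> c1 x0" by blast
    then have lk: "l < k" using c1(1) x0 by auto
    \<comment> \<open>Removing the colour class \<open>S\<close> of \<open>w\<close> lowers the weight of every clique that could exceed
      \<open>k - 1\<close>: a clique missing \<open>S\<close> misses \<open>x0\<close>, so its weight is bounded by the colouring \<open>c1\<close>.\<close>
    define S where "S = {x\<in>V. l \<in> c1 x}"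
    have fin: "finite (c1 x)" if "x \<in> V" for x using c1(1) that finite_subset by blast
    have Spos: "w x \<ge> 1" if "x \<in> S" for x
    proof -
      have "card (c1 x) > 0" using that fin by (auto simp: S_def card_gt_0_iff)
      then show ?thesis using c1(1) that by (auto simp: S_def split: if_splits)
    qed
    have Sst: "\<not> E x y" if "x \<in> S" "y \<in> S" for x y using c1(2) that by (auto simp: S_def)
    define w2 where "w2 x = w x - (if x \<in> S then 1 else 0)" for x
    have w2: "w x = w2 x + (if x \<in> S then 1 else 0)" for x using Spos[of x] by (auto simp: w2_def)
    have sw2: "sum w K = sum w2 K + card (K \<inter> S)" if "K \<subseteq> V" for K
    proof -
      have "finite K" using that assms(1) finite_subset by blast
      then show ?thesis by (simp add: w2 sum.distrib sum.If_cases)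
    qed
    have "x0 \<in> S" using x0 l by (simp add: S_def)
    have "sum w2 V < sum w V"
    proof -
      have "card (V \<inter> S) > 0" using \<open>x0 \<in> S\<close> x0 assms(1) by (auto simp: card_gt_0_iff)
      then show ?thesis using sw2[of V] by simp
    qed
    moreover have "sum w2 K \<le> k - 1" if K: "K \<subseteq> V" "clique E K" for K
    proof (cases "K \<inter> S = {}")
      case False
      have "finite K" using K assms(1) finite_subset by blast
      then have "card (K \<inter> S) \<ge> 1" using False by (simp add: Suc_leI card_gt_0_iff)
      then show ?thesis using sw2[OF K(1)] less.prems[OF K] by simp
    next
      case True
      have finK: "finite K" using K assms(1) finite_subset by blast
      have "x0 \<notin> K" using True \<open>x0 \<in> S\<close> by blast
      then have "sum w2 K = sum ?w K"
        using True by (intro sum.cong) (auto simp: w2_def)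
      also have "\<dots> = (\<Sum>x\<in>K. card (c1 x))" using c1(1) K by (intro sum.cong) auto
      also have "\<dots> = card (\<Union>x\<in>K. c1 x)"
      proof (rule card_UN_disjoint[symmetric, OF finK])
        show "\<forall>i\<in>K. finite (c1 i)" using fin K by auto
        show "\<forall>i\<in>K. \<forall>j\<in>K. i \<noteq> j \<longrightarrow> c1 i \<inter> c1 j = {}"
          using c1(2) K unfolding clique_def by blast
      qed
      also have "\<dots> \<le> card ({..<k} - {l})"
      proof (rule card_mono)
        show "(\<Union>x\<in>K. c1 x) \<subseteq> {..<k} - {l}" using c1(1) K True unfolding S_def by blast
      qed simp
      also have "\<dots> = k - 1" using lk by simp
      finally show ?thesis .
    qed
    ultimately obtain c2 where c2: "\<forall>x\<in>V. c2 x \<subseteq> {..<k-1} \<and> card (c2 x) = w2 x"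
        "\<forall>x\<in>V. \<forall>y\<in>V. E x y \<longrightarrow> c2 x \<inter> c2 y = {}"
      using less.hyps[of w2 "k - 1"] by blast
    \<comment> \<open>The remaining weights are coloured with colours below \<open>k - 1\<close>;
      the colour \<open>k - 1\<close> goes to the stable set \<open>S\<close>.\<close>
    let ?c = "\<lambda>x. if x \<in> S then insert (k - 1) (c2 x) else c2 x"
    have "?c x \<subseteq> {..<k} \<and> card (?c x) = w x" if "x \<in> V" for x
    proof -
      have sub: "c2 x \<subseteq> {..<k-1}" and card: "card (c2 x) = w2 x" using c2 that by auto
      have "finite (c2 x)" "k - 1 \<notin> c2 x" using sub finite_subset by auto
      then show ?thesis using sub card lk by (auto simp: w2[of x])
    qed
    moreover have "?c x \<inter> ?c y = {}" if "x \<in> V" "y \<in> V" "E x y" for x y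
    proof -
      have "k - 1 \<notin> c2 x" "k - 1 \<notin> c2 y" using c2(1) that by auto
      moreover have "c2 x \<inter> c2 y = {}" using c2(2) that by blast
      ultimately show ?thesis using Sst that by auto
    qed
    ultimately show ?thesis by (intro exI[of _ ?c]) blast
  qed
qed

section \<open>Complements of perfect graphs\<close>

lemma sum_card_swap:
  assumes "finite A" "finite B"
  shows "(\<Sum>a\<in>A. card {b\<in>B. R a b}) = (\<Sum>b\<in>B. card {a\<in>A. R a b})"
proof -
  have "(\<Sum>a\<in>A. card {b\<in>B. R a b}) = (\<Sum>a\<in>A. \<Sum>b\<in>B. if R a b then 1 else 0)"
    using assms by (simp add: sum.If_cases Int_def)
  also have "\<dots> = (\<Sum>b\<in>B. \<Sum>a\<in>A. if R a b then 1 else 0)" by (rule sum.swap)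
  also have "\<dots> = (\<Sum>b\<in>B. card {a\<in>A. R a b})"
    using assms by (simp add: sum.If_cases Int_def)
  finally show ?thesis .
qed

lemma clique_co: "irreflp E \<Longrightarrow> clique (co E) S \<longleftrightarrow> (\<forall>x\<in>S. \<forall>y\<in>S. \<not> E x y)"
  unfolding clique_def co_def by (metis irreflpD)

text \<open>Otherwise every clique \<open>K\<close> misses a stable set \<open>S K\<close> of size \<open>k\<close>. Weighting each vertex by the number
  of these stable sets containing it gives cliques of weight less than the number \<open>N\<close> of cliques and
  total weight \<open>N * k\<close>, which \<open>N - 1\<close> stable sets cannot cover.\<close>
lemma clique_meeting_stable_sets:
  assumes "finite X" "hperfect X E" "irreflp E" "cliques_le (co E) X k" "k \<ge> 1"
  obtains K where "K \<subseteq> X" "clique E K" "cliques_le (co E) (X - K) (k - 1)"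
proof (rule ccontr)
  assume "\<not> thesis"
  then have "\<exists>S. S \<subseteq> X - K \<and> clique (co E) S \<and> card S = k" if "K \<subseteq> X" "clique E K" for K
  proof -
    have "\<not> cliques_le (co E) (X - K) (k - 1)" using that \<open>\<not> thesis\<close> \<open>\<And>K. \<lbrakk>K \<subseteq> X; clique E K; cliques_le (co E) (X - K) (k - 1)\<rbrakk> \<Longrightarrow> thesis\<close> by blast
    then obtain S where S: "S \<subseteq> X - K" "clique (co E) S" "\<not> card S \<le> k - 1"
      unfolding cliques_le_def by blast
    moreover have "card S \<le> k" using assms(4) S unfolding cliques_le_def by blast
    ultimately show ?thesis by (intro exI[of _ S]) auto
  qed
  then obtain S where S: "\<And>K. K \<subseteq> X \<Longrightarrow> clique E K \<Longrightarrow> S K \<subseteq> X - K \<and> clique (co E) (S K) \<and> card (S K) = k"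
    by metis
  define F where "F = {K. K \<subseteq> X \<and> clique E K}"
  have finF: "finite F" unfolding F_def using assms(1) by auto
  have "{} \<in> F" by (simp add: F_def clique_def)
  then have "card F > 0" using finF by (auto simp: card_gt_0_iff)
  then have N: "card F \<ge> 1" by simp
  define w where "w x = card {K\<in>F. x \<in> S K}" for x
  have total: "sum w Y = (\<Sum>K\<in>F. card (Y \<inter> S K))" if "Y \<subseteq> X" for Y
  proof -
    have "finite Y" using that assms(1) finite_subset by blast
    then show ?thesis unfolding w_def using sum_card_swap[OF _ finF, of Y "\<lambda>x K. x \<in> S K"]
      by (simp add: Int_def)
  qed
  have wle: "sum w K0 \<le> card F - 1" if K0: "K0 \<subseteq> X" "clique E K0" for K0
  proof -
    have "K0 \<in> F" using K0 by (simp add: F_def)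
    have one: "card (K0 \<inter> S K) \<le> 1" if "K \<in> F" for K
    proof -
      have fin: "finite (K0 \<inter> S K)" using K0 assms(1) finite_subset by blast
      have "clique (co E) (S K)" using S that by (simp add: F_def)
      then have "x = y" if "x \<in> K0 \<inter> S K" "y \<in> K0 \<inter> S K" for x y
        using K0(2) that unfolding clique_def co_def by blast
      then show ?thesis using fin by (simp add: card_le_Suc0_iff_eq)
    qed
    \<comment> \<open>The stable set chosen for \<open>K0\<close> misses it and every other one
      meets it at most once; hence the bound \<open>card F - 1\<close>.\<close>
    have "K0 \<inter> S K0 = {}" using S K0 by blast
    then have "(\<Sum>K\<in>F. card (K0 \<inter> S K)) = (\<Sum>K\<in>F - {K0}. card (K0 \<inter> S K))"
      using finF \<open>K0 \<in> F\<close> by (simp add: sum.remove)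
    also have "\<dots> \<le> (\<Sum>K\<in>F - {K0}. 1)" using one by (intro sum_mono) auto
    also have "\<dots> = card F - 1" using finF \<open>K0 \<in> F\<close> by simp
    finally show ?thesis using total[OF K0(1)] by simp
  qed
  obtain c :: "'a \<Rightarrow> nat set" where c: "\<forall>x\<in>X. c x \<subseteq> {..<card F - 1} \<and> card (c x) = w x"
      "\<forall>x\<in>X. \<forall>y\<in>X. E x y \<longrightarrow> c x \<inter> c y = {}"
    using weighted_colouring[OF assms(1-3), of w "card F - 1"] wle by blast
  \<comment> \<open>The total weight is counted once by the sets \<open>S K\<close>, each of size
    \<open>k\<close>, and once by the \<open>card F - 1\<close> colour classes, each of size at most
    \<open>k\<close>.\<close>
  have "card F * k = (\<Sum>K\<in>F. card (X \<inter> S K))"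
  proof -
    have "card (X \<inter> S K) = k" if "K \<in> F" for K
    proof -
      have "X \<inter> S K = S K" using S that by (auto simp: F_def)
      then show ?thesis using S that by (simp add: F_def)
    qed
    then show ?thesis by simp
  qed
  also have "\<dots> = (\<Sum>x\<in>X. card (c x))" using total[of X] c(1) by simp
  also have "\<dots> = (\<Sum>x\<in>X. card {j\<in>{..<card F - 1}. j \<in> c x})"
  proof (rule sum.cong[OF refl])
    fix x assume "x \<in> X"
    then have "{j\<in>{..<card F - 1}. j \<in> c x} = c x" using c(1) by auto
    then show "card (c x) = card {j\<in>{..<card F - 1}. j \<in> c x}" by simp
  qed
  also have "\<dots> = (\<Sum>j\<in>{..<card F - 1}. card {x\<in>X. j \<in> c x})"
    using assms(1) by (intro sum_card_swap) auto
  also have "\<dots> \<le> (\<Sum>j\<in>{..<card F - 1}. k)"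
  proof (rule sum_mono)
    fix j
    have "clique (co E) {x\<in>X. j \<in> c x}"
      using c(2) by (subst clique_co[OF assms(3)]) blast
    then show "card {x\<in>X. j \<in> c x} \<le> k"
      using assms(4)[unfolded cliques_le_def, rule_format, of "{x\<in>X. j \<in> c x}"] by simp
  qed
  finally have "card F * k \<le> (card F - 1) * k" by simp
  then show False using N assms(5) by (cases "card F") auto
qed

lemma hperfect_mono: "hperfect V E \<Longrightarrow> X \<subseteq> V \<Longrightarrow> hperfect X E"
  unfolding hperfect_def by auto

text \<open>A clique meeting all stable sets of size \<open>Suc k\<close> receives one new colour in
  the complement, and the induction on the number of colours handles the rest.\<close>

theorem hperfect_co:
  assumes "finite V" "hperfect V E" "irreflp E"
  shows "hperfect V (co E)"
proof -
  have "colourable (co E) X k" if "X \<subseteq> V" "cliques_le (co E) X k" for X k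
    using that
  proof (induction k arbitrary: X)
    case 0
    have "X = {}"
    proof (rule ccontr)
      assume "X \<noteq> {}"
      then obtain x where "x \<in> X" by blast
      then have "{x} \<subseteq> X" "clique (co E) {x}" by (auto simp: clique_def)
      then have "card {x} \<le> 0" using 0(2) unfolding cliques_le_def by blast
      then show False by simp
    qed
    then show ?case by (simp add: colourable_def)
  next
    case (Suc k)
    have "finite X" using Suc.prems assms(1) finite_subset by blast
    then obtain K where K: "K \<subseteq> X" "clique E K" "cliques_le (co E) (X - K) k"
      using clique_meeting_stable_sets[of X E "Suc k"] hperfect_mono[OF assms(2) Suc.prems(1)] assms(3) Suc.prems(2)
      by auto
    then have "colourable (co E) (X - K) k" using Suc.IH[of "X - K"] Suc.prems by blast
    then obtain c where c: "\<forall>x\<in>X-K. c x < k" "\<forall>x\<in>X-K. \<forall>y\<in>X-K. co E x y \<longrightarrow> c x \<noteq> c y"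
      unfolding colourable_def by blast
    have KK: "\<not> co E x y" if "x \<in> K" "y \<in> K" for x y using K(2) that by (auto simp: clique_def co_def)
    let ?c = "\<lambda>x. if x \<in> K then k else c x"
    have lt: "c x < k" if "x \<in> X" "x \<notin> K" for x using c(1) that by blast
    have "?c x < Suc k" if "x \<in> X" for x using lt[of x] that by auto
    moreover have "?c x \<noteq> ?c y" if "x \<in> X" "y \<in> X" "co E x y" for x y
      using lt[of x] lt[of y] KK[of x y] c(2) that by auto
    ultimately show ?case unfolding colourable_def by (intro exI[of _ ?c]) blast
  qed
  then show ?thesis unfolding hperfect_def by blast
qed

section \<open>Minimum imperfect graphs\<close>

text \<open>The function \<open>co E\<close> relates vertices outside \<open>V\<close>, so it is not a graph in the sense of \<open>graph\<close>.\<close>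
definition co_on :: "'a set \<Rightarrow> ('a \<Rightarrow> 'a \<Rightarrow> bool) \<Rightarrow> 'a \<Rightarrow> 'a \<Rightarrow> bool" where
  "co_on V E x y \<longleftrightarrow> x \<in> V \<and> y \<in> V \<and> co E x y"

lemma graphD:
  assumes "graph V E"
  shows "finite V" "symp E" "irreflp E"
  using assms unfolding graph_def symp_def irreflp_def by blast+

lemma co_co: "irreflp E \<Longrightarrow> co (co E) = E"
  unfolding co_def irreflp_def by blast

lemma colourable_cong:
  "(\<And>x y. x \<in> X \<Longrightarrow> y \<in> X \<Longrightarrow> E x y \<longleftrightarrow> F x y) \<Longrightarrow> colourable E X k \<longleftrightarrow> colourable F X k"
  unfolding colourable_def by (intro ex_cong1) auto

lemma cliques_le_cong:
  assumes "\<And>x y. x \<in> X \<Longrightarrow> y \<in> X \<Longrightarrow> E x y \<longleftrightarrow> F x y"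
  shows "cliques_le E X k \<longleftrightarrow> cliques_le F X k"
proof -
  have "clique E K \<longleftrightarrow> clique F K" if "K \<subseteq> X" for K
    using assms that unfolding clique_def by blast
  then show ?thesis unfolding cliques_le_def by blast
qed

lemma cliques_le_mono: "cliques_le E X k \<Longrightarrow> Y \<subseteq> X \<Longrightarrow> cliques_le E Y k"
  unfolding cliques_le_def by blast

lemma hperfect_cong:
  assumes "\<And>x y. x \<in> V \<Longrightarrow> y \<in> V \<Longrightarrow> E x y \<longleftrightarrow> F x y"
  shows "hperfect V E \<longleftrightarrow> hperfect V F"
proof -
  have "colourable E X k \<longleftrightarrow> colourable F X k" "cliques_le E X k \<longleftrightarrow> cliques_le F X k" if "X \<subseteq> V" for X k
    using assms that by (intro colourable_cong cliques_le_cong; blast)+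
  then show ?thesis unfolding hperfect_def by simp
qed

lemma connected_in_cong:
  assumes "\<And>x y. x \<in> D \<Longrightarrow> y \<in> D \<Longrightarrow> R x y \<longleftrightarrow> S x y"
  shows "connected_in R D \<longleftrightarrow> connected_in S D"
proof -
  have "{(u, v). u \<in> D \<and> v \<in> D \<and> R u v} = {(u, v). u \<in> D \<and> v \<in> D \<and> S u v}" using assms by blast
  then show ?thesis unfolding connected_in_def by simp
qed

text \<open>Berge is invariant under complementation, imperfection passes over by
  \<open>hperfect_co\<close>, and minimality refers only to \<open>card V\<close>. Results about one
  side of a skew partition thus transfer to the other.\<close>

lemma minimum_imperfect_co_on:
  assumes "minimum_imperfect V E"
  shows "minimum_imperfect V (co_on V E)"
proof -
  have g: "graph V E" and b: "berge V E" and np: "\<not> perfect V E"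
    and min: "\<forall>(V' :: 'a set) E'. graph V' E' \<and> berge V' E' \<and> card V' < card V \<longrightarrow> perfect V' E'"
    using assms unfolding minimum_imperfect_def by blast+
  note gD = graphD[OF g]
  have g': "graph V (co_on V E)"
    using gD unfolding graph_def co_on_def co_def by (auto dest: sympD)
  note g'D = graphD[OF g']
  have c1: "co_on V E x y \<longleftrightarrow> co E x y" if "x \<in> V" "y \<in> V" for x y using that by (simp add: co_on_def)
  have c2: "co (co_on V E) x y \<longleftrightarrow> E x y" if "x \<in> V" "y \<in> V" for x y
    using that co_co[OF gD(3)] c1 by (metis co_def)
  have "hole V (co E) vs" if "hole V (co_on V E) vs" for vs
    using that by (rule hole_cong) (use that c1 in \<open>auto simp: hole_def\<close>)
  moreover have "hole V E vs" if "hole V (co (co_on V E)) vs" for vs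
    using that by (rule hole_cong) (use that c2 in \<open>auto simp: hole_def\<close>)
  ultimately have "berge V (co_on V E)" using b unfolding berge_def antihole_def by blast
  moreover have "\<not> perfect V (co_on V E)"
  proof
    assume "perfect V (co_on V E)"
    then have "hperfect V (co (co_on V E))"
      using perfect_iff_hperfect[OF gD(1) g'D(3)] hperfect_co[OF gD(1) _ g'D(3)] by blast
    then have "hperfect V E" using hperfect_cong[of V "co (co_on V E)" E] c2 by blast
    then show False using np perfect_iff_hperfect[OF gD(1,3)] by blast
  qed
  ultimately show ?thesis using g' min unfolding minimum_imperfect_def by blast
qed

section \<open>Colourings in a minimum imperfect graph\<close>

locale min_imperfect =
  fixes V :: "'a set" and E :: "'a \<Rightarrow> 'a \<Rightarrow> bool"
  assumes mi: "minimum_imperfect V E"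
begin

lemma graph: "graph V E" and berge: "berge V E"
  using mi unfolding minimum_imperfect_def by blast+

lemmas fin = graphD(1)[OF graph] and sym = graphD(2)[OF graph] and irr = graphD(3)[OF graph]

lemma E_sym: "E a b \<Longrightarrow> E b a" using sym by (auto dest: sympD)

lemma E_V: "E a b \<Longrightarrow> a \<in> V \<and> b \<in> V" using graph by (auto simp: graph_def)

lemma E_irr: "\<not> E a a" using irr by (auto dest: irreflpD)

lemma smaller_perfect:
  fixes V' :: "'a set"
  assumes "graph V' E'" "berge V' E'" "card V' < card V"
  shows "hperfect V' E'"
  using mi assms perfect_iff_hperfect[OF graphD(1,3)[OF assms(1)]]
  unfolding minimum_imperfect_def by blast

lemma proper_subset_perfect:
  assumes "X \<subset> V"
  shows "hperfect X E"
proof -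
  \<comment> \<open>\<open>E\<close> is cut down to \<open>X\<close>, since \<open>graph\<close>
    requires all edges to lie inside the vertex set.\<close>
  let ?F = "\<lambda>x y. x \<in> X \<and> y \<in> X \<and> E x y"
  have finX: "finite X" using assms fin finite_subset by blast
  have "graph X ?F" using graph finX by (auto simp: graph_def)
  moreover have "berge X ?F"
  proof -
    have "hole V E vs" if "hole X ?F vs" for vs
      using that by (rule hole_cong) (use that assms in \<open>auto simp: hole_def\<close>)
    moreover have "hole V (co E) vs" if "hole X (co ?F) vs" for vs
      using that by (rule hole_cong) (use that assms in \<open>auto simp: hole_def co_def\<close>)
    ultimately show ?thesis using berge unfolding berge_def antihole_def by blast
  qed
  moreover have "card X < card V" using assms fin by (rule psubset_card_mono[rotated])
  ultimately have "hperfect X ?F" by (rule smaller_perfect)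
  then show ?thesis using hperfect_cong[of X ?F E] by blast
qed

lemma proper_subset_colourable: "X \<subset> V \<Longrightarrow> cliques_le E X k \<Longrightarrow> colourable E X k"
  using proper_subset_perfect unfolding hperfect_def by blast

text \<open>All proper induced subgraphs are perfect, so the failure occurs at \<open>V\<close>
  itself.\<close>

lemma not_colourable:
  obtains k where "cliques_le E V k" "\<not> colourable E V k"
proof -
  have "\<not> hperfect V E"
    using mi perfect_iff_hperfect[OF fin irr] unfolding minimum_imperfect_def by blast
  then obtain X k where "X \<subseteq> V" "cliques_le E X k" "\<not> colourable E X k"
    unfolding hperfect_def by blast
  then show thesis using that proper_subset_colourable by blast
qed

lemma colourable_Un:
  assumes "colourable E C a" "colourable E D b"
  shows "colourable E (C \<union> D) (a + b)"
proof -
  obtain c where c: "\<forall>x\<in>C. c x < a" "\<forall>x\<in>C. \<forall>y\<in>C. E x y \<longrightarrow> c x \<noteq> c y"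
    using assms(1) unfolding colourable_def by blast
  obtain d where d: "\<forall>x\<in>D. d x < b" "\<forall>x\<in>D. \<forall>y\<in>D. E x y \<longrightarrow> d x \<noteq> d y"
    using assms(2) unfolding colourable_def by blast
  let ?c = "\<lambda>x. if x \<in> C then c x else a + d x"
  have "?c x < a + b" if "x \<in> C \<union> D" for x using c(1) d(1) that by (cases "x \<in> C") (auto intro: trans_less_add1)
  moreover have "?c x \<noteq> ?c y" if "x \<in> C \<union> D" "y \<in> C \<union> D" "E x y" for x y
  proof (cases "x \<in> C"; cases "y \<in> C")
    assume "x \<in> C" "y \<notin> C" then show ?thesis using c(1) by fastforce
  next
    assume "x \<notin> C" "y \<in> C" then show ?thesis using c(1) by fastforce
  qed (use c(2) d(2) that in auto)
  ultimately show ?thesis unfolding colourable_def by (intro exI[of _ ?c] conjI ballI impI) 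
qed

text \<open>Both parts are proper subsets of \<open>V\<close>, so they can be coloured with disjoint
  palettes of \<open>a\<close> and \<open>k - a\<close> colours.\<close>

lemma no_good_split:
  assumes "cliques_le E V k" "\<not> colourable E V k" "C \<subset> V" "C \<noteq> {}" "a \<le> k"
    "cliques_le E C a" "cliques_le E (V - C) (k - a)"
  shows False
proof -
  have "colourable E C a" "colourable E (V - C) (k - a)"
    using assms by (auto intro!: proper_subset_colourable)
  from colourable_Un[OF this] have "colourable E V k"
    using assms by (simp add: Un_absorb1 psubset_imp_subset)
  then show False using assms by blast
qed

text \<open>A colouring of the graph without \<open>a\<close> extends by giving \<open>a\<close> the
  colour of \<open>b\<close>.\<close>

lemma no_dominated_vertex:
  assumes "a \<in> V" "b \<in> V" "a \<noteq> b" "\<not> E a b" "\<And>x. E a x \<Longrightarrow> E b x"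
  shows False
proof -
  obtain k where k: "cliques_le E V k" "\<not> colourable E V k" using not_colourable .
  have "V - {a} \<subset> V" using assms by blast
  then have "colourable E (V - {a}) k"
    using cliques_le_mono[OF k(1)] by (intro proper_subset_colourable) auto
  then obtain c where c: "\<forall>x\<in>V-{a}. c x < k" "\<forall>x\<in>V-{a}. \<forall>y\<in>V-{a}. E x y \<longrightarrow> c x \<noteq> c y"
    unfolding colourable_def by blast
  let ?c = "c(a := c b)"
  have "?c x < k" if "x \<in> V" for x using c(1) that assms by auto
  moreover have "?c x \<noteq> ?c y" if "x \<in> V" "y \<in> V" "E x y" for x y
  proof (cases "x = a"; cases "y = a")
    assume "x = a" "y = a" then show ?thesis using that E_irr by blast
  next
    assume "x = a" "y \<noteq> a" then show ?thesis using that assms c(2) by auto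
  next
    assume "x \<noteq> a" "y = a" then show ?thesis using that assms c(2) E_sym by (metis DiffI fun_upd_apply singletonD)
  qed (use c(2) that in auto)
  ultimately have "colourable E V k" unfolding colourable_def by blast
  then show False using k by blast
qed

text \<open>Both \<open>V - P1\<close> and \<open>V - P2\<close> can be coloured with
  \<open>k\<close> colours. The vertices sharing the colour of \<open>a\<close> in either colouring
  form a stable set \<open>I\<close> meeting every clique of size \<open>k\<close>, and what remains
  needs only \<open>k - 1\<close> colours.\<close>

lemma no_star_cutset:
  assumes "a \<in> V" "{x\<in>V. x \<noteq> a \<and> \<not> E a x} = P1 \<union> P2" "P1 \<inter> P2 = {}" "P1 \<noteq> {}" "P2 \<noteq> {}"
    and P: "\<And>p q. p \<in> P1 \<Longrightarrow> q \<in> P2 \<Longrightarrow> \<not> E p q"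
  shows False
proof -
  obtain k where k: "cliques_le E V k" "\<not> colourable E V k" using not_colourable .
  have col: "\<exists>c. (\<forall>x\<in>V-P. c x < k) \<and> (\<forall>x\<in>V-P. \<forall>y\<in>V-P. E x y \<longrightarrow> c x \<noteq> c y)" if "P = P1 \<or> P = P2" for P
  proof -
    have "V - P \<subset> V" using assms(2,4,5) that by blast
    then have "colourable E (V - P) k"
      using cliques_le_mono[OF k(1)] by (intro proper_subset_colourable) auto
    then show ?thesis unfolding colourable_def .
  qed
  obtain c1 :: "'a \<Rightarrow> nat" where
    c1: "\<forall>x\<in>V-P2. c1 x < k" "\<forall>x\<in>V-P2. \<forall>y\<in>V-P2. E x y \<longrightarrow> c1 x \<noteq> c1 y"
    using col[of P2] by blast
  obtain c2 :: "'a \<Rightarrow> nat" where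
    c2: "\<forall>x\<in>V-P1. c2 x < k" "\<forall>x\<in>V-P1. \<forall>y\<in>V-P1. E x y \<longrightarrow> c2 x \<noteq> c2 y"
    using col[of P1] by blast
  have aP: "a \<in> V - P1" "a \<in> V - P2" using assms(1,2) by blast+
  define I where "I = {x\<in>V-P2. c1 x = c1 a} \<union> {x\<in>V-P1. c2 x = c2 a}"
  have "a \<in> I" using aP by (simp add: I_def)
  have I: "x = a \<or> x \<in> P1 \<or> x \<in> P2" if "x \<in> I" for x
  proof (rule ccontr)
    assume *: "\<not> ?thesis"
    have "x \<in> V" using that by (auto simp: I_def)
    then have "E a x" using * assms(2) by blast
    then have "c1 a \<noteq> c1 x" "c2 a \<noteq> c2 x" using c1(2) c2(2) aP \<open>x \<in> V\<close> * by blast+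
    then show False using that by (auto simp: I_def)
  qed
  have stable: "\<not> E x y" if xy: "x \<in> I" "y \<in> I" for x y
  proof
    assume "E x y"
    have P': "\<not> E p q" if "p \<in> P2" "q \<in> P1" for p q using P that E_sym by blast
    have na: "\<not> E a z" "\<not> E z a" if "z \<in> I" for z using I[OF that] assms(2) E_sym E_irr by blast+
    have "x \<in> P1 \<and> y \<in> P1 \<or> x \<in> P2 \<and> y \<in> P2"
      using I[OF xy(1)] I[OF xy(2)] na xy \<open>E x y\<close> P P' by blast
    then show False
    proof
      assume "x \<in> P1 \<and> y \<in> P1"
      then have "c1 x = c1 a" "c1 y = c1 a" "x \<in> V - P2" "y \<in> V - P2" using xy assms(3) by (auto simp: I_def)
      then show False using c1(2) \<open>E x y\<close> by metis
    next
      assume "x \<in> P2 \<and> y \<in> P2"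
      then have "c2 x = c2 a" "c2 y = c2 a" "x \<in> V - P1" "y \<in> V - P1" using xy assms(3) by (auto simp: I_def)
      then show False using c2(2) \<open>E x y\<close> by metis
    qed
  qed
  have IV: "I \<subseteq> V" by (auto simp: I_def)
  have k1: "1 \<le> k" using c1(1) aP by (metis le_less_trans less_one not_le zero_le)
  have "cliques_le E (V - I) (k - 1)"
    unfolding cliques_le_def
  proof (intro allI impI)
    fix K assume K: "K \<subseteq> V - I" "clique E K"
    \<comment> \<open>A clique missing \<open>P\<close> is coloured injectively by \<open>c\<close>,
      and outside \<open>I\<close> the colour \<open>c a\<close> does not occur, which leaves
      \<open>k - 1\<close> colours.\<close>
    have bound: "card K \<le> k - 1"
      if sub: "K \<subseteq> V - P" and c: "\<forall>x\<in>V-P. c x < k" "\<forall>x\<in>V-P. \<forall>y\<in>V-P. E x y \<longrightarrow> c x \<noteq> c y"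
        and a: "a \<in> V - P" and J: "\<And>x. x \<in> V - P \<Longrightarrow> c x = c a \<Longrightarrow> x \<in> I" for P and c :: "'a \<Rightarrow> nat"
    proof -
      have "inj_on c K" using c sub K(2) unfolding inj_on_def clique_def by blast
      then have "card K = card (c ` K)" by (simp add: card_image)
      also have "\<dots> \<le> card ({..<k} - {c a})"
      proof (rule card_mono)
        show "c ` K \<subseteq> {..<k} - {c a}"
        proof (rule image_subsetI)
          fix x assume x: "x \<in> K"
          then have "x \<in> V - P" "x \<notin> I" using sub K(1) by auto
          then show "c x \<in> {..<k} - {c a}" using c(1) J[of x] by auto
        qed
      qed simp
      also have "\<dots> = k - 1" using c(1) a by simp
      finally show ?thesis .
    qed
    have "K \<inter> P1 = {} \<or> K \<inter> P2 = {}"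
    proof (rule ccontr)
      assume "\<not> ?thesis"
      then obtain p q where pq: "p \<in> K" "p \<in> P1" "q \<in> K" "q \<in> P2" by blast
      then have "p \<noteq> q" using assms(3) by blast
      then have "E p q" using K(2) pq(1,3) by (simp add: clique_def)
      then show False using P pq(2,4) by blast
    qed
    then show "card K \<le> k - 1"
    proof
      assume "K \<inter> P1 = {}"
      then show ?thesis using K c2 aP by (intro bound[of P1 c2]) (auto simp: I_def)
    next
      assume "K \<inter> P2 = {}"
      then show ?thesis using K c1 aP by (intro bound[of P2 c1]) (auto simp: I_def)
    qed
  qed
  moreover have "V - I \<subset> V" using \<open>a \<in> I\<close> assms(1) by blast
  ultimately have "colourable E (V - I) (k - 1)" by (intro proper_subset_colourable)
  moreover have "colourable E I 1" unfolding colourable_def using stable by (intro exI[of _ "\<lambda>_. 0"]) auto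
  ultimately have "colourable E (V - I \<union> I) (k - 1 + 1)" by (rule colourable_Un)
  moreover have "V - I \<union> I = V" using IV by blast
  ultimately show False using k k1 by simp
qed

end

section \<open>Skew partitions with both sides split\<close>

definition quad :: "'a set \<Rightarrow> ('a \<Rightarrow> 'a \<Rightarrow> bool) \<Rightarrow> 'a set \<Rightarrow> 'a set \<Rightarrow> 'a set \<Rightarrow> 'a set \<Rightarrow> bool" where
  "quad V E A1 A2 B1 B2 \<longleftrightarrow> V = A1 \<union> A2 \<union> B1 \<union> B2 \<and>
     A1 \<inter> A2 = {} \<and> B1 \<inter> B2 = {} \<and> (A1 \<union> A2) \<inter> (B1 \<union> B2) = {} \<and>
     A1 \<noteq> {} \<and> A2 \<noteq> {} \<and> B1 \<noteq> {} \<and> B2 \<noteq> {} \<and>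
     (\<forall>x\<in>A1. \<forall>y\<in>A2. \<not> E x y \<and> \<not> E y x) \<and> (\<forall>x\<in>B1. \<forall>y\<in>B2. E x y \<and> E y x)"

lemma quad_swap:
  assumes "quad V E A1 A2 B1 B2"
  shows "quad V E A2 A1 B1 B2" "quad V E A1 A2 B2 B1"
  using assms unfolding quad_def by blast+

lemma quad_co_on:
  assumes "quad V E A1 A2 B1 B2"
  shows "quad V (co_on V E) B1 B2 A1 A2"
  using assms unfolding quad_def co_on_def co_def by blast

context min_imperfect
begin

text \<open>If \<open>a\<close> has neighbours on both sides, its neighbourhood splits in the complement, where \<open>a\<close> is
  thus the centre of a star cutset. Otherwise \<open>a\<close> is dominated by a vertex of \<open>B1\<close> or \<open>B2\<close>.\<close>
lemma quad_not_singleton: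
  assumes "quad V E {a} A2 B1 B2"
  shows False
proof -
  have V: "V = {a} \<union> A2 \<union> B1 \<union> B2" and disj: "a \<notin> B1" "a \<notin> B2" "a \<notin> A2" "B1 \<inter> B2 = {}" "A2 \<inter> (B1 \<union> B2) = {}"
    and ne: "B1 \<noteq> {}" "B2 \<noteq> {}" and aA: "\<And>x. x \<in> A2 \<Longrightarrow> \<not> E a x"
    and B: "\<And>x y. x \<in> B1 \<Longrightarrow> y \<in> B2 \<Longrightarrow> E x y \<and> E y x"
    using assms unfolding quad_def by auto
  \<comment> \<open>If \<open>a\<close> has no neighbour in \<open>B1'\<close>, all its neighbours
    lie in \<open>B2'\<close>, to which every vertex of \<open>B1'\<close> is complete.\<close>
  have dom: False if "B1' = B1 \<and> B2' = B2 \<or> B1' = B2 \<and> B2' = B1" "\<forall>x\<in>B1'. \<not> E a x" for B1' B2'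
  proof -
    have "B1' \<noteq> {}" using that ne by blast
    then obtain b where b: "b \<in> B1'" by blast
    note P = \<open>B1' = B1 \<and> B2' = B2 \<or> B1' = B2 \<and> B2' = B1\<close> \<open>\<forall>x\<in>B1'. \<not> E a x\<close>
    show False
    proof (rule no_dominated_vertex[of a b])
      show "a \<in> V" "b \<in> V" "a \<noteq> b" "\<not> E a b" using V disj b P by auto
      fix x assume "E a x"
      then have "x \<in> V" "x \<noteq> a" "x \<notin> A2" "x \<notin> B1'" using E_V E_irr aA P(2) by blast+
      then have "x \<in> B2'" using V P(1) by blast
      then show "E b x" using b B P(1) by blast
    qed
  qed
  interpret C: min_imperfect V "co_on V E"
    using minimum_imperfect_co_on[OF mi] by unfold_locales
  show False
  proof (rule C.no_star_cutset[of a "{x\<in>B1. E a x}" "{x\<in>B2. E a x}"])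
    show "a \<in> V" using V by blast
    show "{x \<in> V. x \<noteq> a \<and> \<not> co_on V E a x} = {x \<in> B1. E a x} \<union> {x \<in> B2. E a x}"
      using V disj aA E_irr unfolding co_on_def co_def by blast
    show "{x \<in> B1. E a x} \<noteq> {}" "{x \<in> B2. E a x} \<noteq> {}" using dom[of B1 B2] dom[of B2 B1] by blast+
    show "{x \<in> B1. E a x} \<inter> {x \<in> B2. E a x} = {}" using disj by blast
    show "\<not> co_on V E p q" if "p \<in> {x \<in> B1. E a x}" "q \<in> {x \<in> B2. E a x}" for p q
      using B that unfolding co_on_def co_def by blast
  qed
qed

text \<open>Needed in \<open>half_split\<close>, where one side is replaced by a single new vertex
  and the graph must become smaller.\<close>

lemma quad_card_A:
  assumes "quad V E A1 A2 B1 B2"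
  shows "card A1 \<ge> 2"
proof (rule ccontr)
  assume "\<not> ?thesis"
  moreover have "finite A1" "A1 \<noteq> {}" using assms fin unfolding quad_def by auto
  ultimately have "card A1 = 1" by (metis One_nat_def Suc_1 Suc_leI card_gt_0_iff le_antisym not_less_eq_eq)
  then obtain a where "A1 = {a}" by (rule card_1_singletonE)
  then show False using quad_not_singleton assms by blast
qed

end

lemma quad_card_B:
  assumes "minimum_imperfect V E" "quad V E A1 A2 B1 B2"
  shows "card B1 \<ge> 2"
  using min_imperfect.quad_card_A[OF min_imperfect.intro[OF minimum_imperfect_co_on[OF assms(1)]] quad_co_on[OF assms(2)]] .

section \<open>Ends and interiors of paths, and balance for parts\<close>

lemma set_butlast_tl:
  assumes "x \<in> set (butlast (tl vs))"
  obtains k where "0 < k" "Suc k < length vs" "x = vs!k"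
proof -
  obtain k where "k < length (butlast (tl vs))" "x = butlast (tl vs) ! k"
    using assms by (auto simp: in_set_conv_nth)
  then show thesis using that[of "Suc k"] by (simp add: nth_butlast nth_tl)
qed

lemma set_path_cases:
  assumes "x \<in> set vs"
  shows "x = hd vs \<or> x = last vs \<or> x \<in> set (butlast (tl vs))"
proof (cases vs)
  case (Cons a ws)
  then show ?thesis using assms by (cases ws rule: rev_cases) auto
qed (use assms in simp)

lemma ind_path_ConsD:
  assumes "ind_path V E (x # R)" "w \<in> set R" "E x w"
  shows "w = hd R"
proof -
  obtain k where "k < length R" "w = R!k" using assms(2) by (auto simp: in_set_conv_nth)
  then show ?thesis using ind_path_adj[OF assms(1), of 0 "Suc k"] assms(3) by (cases R) auto
qed

lemma ind_path_split_ends: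
  assumes "ind_path V E vs" "hd vs \<noteq> last vs" "\<not> E (hd vs) (last vs)"
  obtains R where "vs = hd vs # R @ [last vs]" "R \<noteq> []"
proof -
  obtain a ws where vs: "vs = a # ws" using assms(1) by (cases vs) (auto simp: ind_path_def)
  have "ws \<noteq> []" using vs assms(2) by auto
  then obtain us b where ws: "ws = us @ [b]" by (cases ws rule: rev_cases) auto
  have "us \<noteq> []"
  proof
    assume "us = []"
    then have "vs = [a, b]" using ws vs by simp
    then show False using ind_path_adj[OF assms(1), of 0 1] assms(3) by simp
  qed
  then show thesis using that[of us] vs ws by simp
qed

lemma ind_path_even_length:
  assumes "ind_path V E vs" "even (length vs)" "\<not> E (hd vs) (last vs)"
  shows "length vs \<ge> 4" "hd vs \<noteq> last vs"
proof -
  have ne: "vs \<noteq> []" and d: "distinct vs" using assms(1) by (auto simp: ind_path_def)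
  have "length vs \<noteq> 2"
  proof
    assume "length vs = 2"
    then obtain a b where "vs = [a, b]" by (auto simp: length_Suc_conv numeral_2_eq_2)
    then show False using assms(3) ind_path_adj[OF assms(1), of 0 1] by simp
  qed
  moreover have "length vs \<noteq> 0" "length vs \<noteq> 1" "length vs \<noteq> 3" using assms(2) ne by auto
  ultimately show len: "length vs \<ge> 4" by linarith
  have "vs!0 \<noteq> vs!(length vs - 1)" using d len ne by (subst nth_eq_iff_index_eq) auto
  then show "hd vs \<noteq> last vs" using ne by (simp add: hd_conv_nth last_conv_nth)
qed

text \<open>Parities refer to the number of vertices, one more than the length. \<open>A\<close> and
  \<open>B\<close> need not partition \<open>V\<close>, so the notion passes to parts of a skew
  partition.\<close>

definition balanced_pair :: "'a set \<Rightarrow> ('a \<Rightarrow> 'a \<Rightarrow> bool) \<Rightarrow> 'a set \<Rightarrow> 'a set \<Rightarrow> bool" where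
  "balanced_pair V E A B \<longleftrightarrow>
     (\<forall>vs. ind_path V E vs \<and> hd vs \<in> B \<and> last vs \<in> B \<and> \<not> E (hd vs) (last vs)
        \<and> set (butlast (tl vs)) \<subseteq> A \<longrightarrow> odd (length vs)) \<and>
     (\<forall>vs. ind_path V (co E) vs \<and> hd vs \<in> A \<and> last vs \<in> A \<and> E (hd vs) (last vs)
        \<and> set (butlast (tl vs)) \<subseteq> B \<longrightarrow> odd (length vs))"

lemma balanced_pair_mono:
  assumes "balanced_pair V E A B" "A' \<subseteq> A" "B' \<subseteq> B"
  shows "balanced_pair V E A' B'"
  unfolding balanced_pair_def
proof (intro conjI allI impI; elim conjE)
  fix vs assume "ind_path V E vs" "hd vs \<in> B'" "last vs \<in> B'" "\<not> E (hd vs) (last vs)"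
    "set (butlast (tl vs)) \<subseteq> A'"
  moreover from this have "hd vs \<in> B" "last vs \<in> B" "set (butlast (tl vs)) \<subseteq> A"
    using assms(2,3) by auto
  ultimately show "odd (length vs)" using assms(1) by (simp add: balanced_pair_def)
next
  fix vs assume "ind_path V (co E) vs" "hd vs \<in> A'" "last vs \<in> A'" "E (hd vs) (last vs)"
    "set (butlast (tl vs)) \<subseteq> B'"
  moreover from this have "hd vs \<in> A" "last vs \<in> A" "set (butlast (tl vs)) \<subseteq> B"
    using assms(2,3) by auto
  ultimately show "odd (length vs)" using assms(1) by (simp add: balanced_pair_def)
qed

lemma balanced_imp_pair:
  assumes "balanced V E A B"
  shows "balanced_pair V E A B"
proof -
  have odd: "odd (length vs - 1) \<longleftrightarrow> even (length vs)" if "ind_path V F vs" for vs :: "'a list" and F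
    using that by (cases vs) (auto simp: ind_path_def)
  show ?thesis
    using assms odd unfolding balanced_def balanced_pair_def by blast
qed

lemma hole_of_even_path:
  assumes "symp R" "irreflp R" "ind_path V R vs" "even (length vs)" "\<not> R (hd vs) (last vs)" "z \<in> V" "z \<notin> set vs"
    and "R z (hd vs)" "R z (last vs)" "\<And>p. p \<in> set (butlast (tl vs)) \<Longrightarrow> \<not> R z p"
  shows "hole V R (z # vs)"
proof (rule hole_ConsI[OF assms(1-3) _ assms(6-9)])
  show "length vs \<ge> 3" using ind_path_even_length(1)[OF assms(3-5)] by simp
  show "p = hd vs \<or> p = last vs" if "p \<in> set vs" "R z p" for p
    using set_path_cases[OF that(1)] assms(10) that(2) by blast
qed

section \<open>Adding a vertex and splitting along colours\<close>

context min_imperfect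
begin

lemma no_odd_hole: "hole V E vs \<Longrightarrow> even (length vs)"
  and no_odd_antihole: "hole V (co E) vs \<Longrightarrow> even (length vs)"
  using berge unfolding berge_def antihole_def by auto

text \<open>On an odd hole through \<open>z\<close> only the two neighbours of \<open>z\<close> lie
  in \<open>B2\<close>, and a vertex of \<open>B1\<close> would be adjacent to both of these; what
  remains is a path excluded by \<open>balanced_pair\<close>. On an odd antihole the roles are
  exchanged: interior in \<open>B2\<close>, ends in \<open>A\<close>.\<close>

lemma berge_add_vertex:
  assumes W: "W = A \<union> B1 \<union> B2" "W \<subseteq> V" "z \<notin> W" "A \<inter> (B1 \<union> B2) = {}" "B1 \<inter> B2 = {}"
    and compl: "\<And>x y. x \<in> B1 \<Longrightarrow> y \<in> B2 \<Longrightarrow> E x y" and bal: "balanced_pair V E A B2"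
    and F: "\<And>x y. F x y \<longleftrightarrow> x \<in> W \<and> y \<in> W \<and> E x y \<or> x = z \<and> y \<in> B2 \<or> y = z \<and> x \<in> B2"
  shows "berge (insert z W) F"
proof -
  have FW: "F x y \<longleftrightarrow> E x y" if "x \<in> W" "y \<in> W" for x y using that W F by auto
  have Fz: "F z x \<longleftrightarrow> x \<in> B2" if "x \<in> W" for x using that W F by auto
  have coFW: "co F x y \<longleftrightarrow> co E x y" if "x \<in> W" "y \<in> W" for x y using FW[OF that] by (simp add: co_def)
  have coFz: "co F z x \<longleftrightarrow> x \<notin> B2" if "x \<in> W" for x using Fz[OF that] that W(3) by (auto simp: co_def)
  have "even (length vs)" if h0: "hole (insert z W) F vs" for vs
  proof (cases "z \<in> set vs")
    case False
    have vs: "set vs \<subseteq> W" using that False by (auto simp: hole_def)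
    have "hole V E vs"
      by (rule hole_cong[OF that]) (use vs W(2) FW in blast)+
    then show ?thesis using no_odd_hole by blast
  next
    case True
    then obtain ps where h: "hole (insert z W) F (z # ps)" and len: "length vs = Suc (length ps)"
      using hole_rotate_to[OF h0 True] by blast
    note hD = hole_ConsD[OF h]
    have ps: "set ps \<subseteq> W" "ps \<noteq> []" "distinct ps" using hD(1,2) by (auto simp: ind_path_def)
    have path: "ind_path V E ps" 
      by (rule ind_path_cong[OF hD(1)]) (use ps(1) W(2) FW in blast)+
    have "hd ps \<in> W" "last ps \<in> W" using ps(1,2) by (meson hd_in_set last_in_set subsetD)+
    then have ends: "hd ps \<in> B2" "last ps \<in> B2" using hD(4,5) Fz by simp_all
    have hl: "hd ps = ps!0" "last ps = ps!(length ps - 1)" using ps by (simp_all add: hd_conv_nth last_conv_nth)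
    show ?thesis
    proof (rule ccontr)
      assume "odd (length vs)"
      then have ev: "even (length ps)" using len by simp
      then have "length ps \<noteq> 3" by auto
      then have n4: "length ps \<ge> 4" using hD(3) by linarith
      have "\<not> E (hd ps) (last ps)" unfolding hl using n4 by (subst ind_path_adj[OF path]) auto
      moreover have "set (butlast (tl ps)) \<subseteq> A"
      proof
        fix x assume "x \<in> set (butlast (tl ps))"
        then obtain k where k: "0 < k" "Suc k < length ps" "x = ps!k" by (rule set_butlast_tl)
        then have xp: "x \<in> set ps" by auto
        have "x \<noteq> hd ps" "x \<noteq> last ps" unfolding hl k(3) using k n4 ps
          by (auto simp: nth_eq_iff_index_eq)
        then have "x \<notin> B2" using hD(6)[OF xp] Fz[of x] xp ps(1) by blast
        moreover have "x \<notin> B1"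
        proof
          assume "x \<in> B1"
          then have "E x (hd ps)" "E x (last ps)" using compl ends by auto
          moreover have "k < length ps" "0 < length ps" "length ps - 1 < length ps" using k n4 by linarith+
          ultimately have "k = Suc 0 \<or> 0 = Suc k" "k = Suc (length ps - 1) \<or> length ps - 1 = Suc k"
            unfolding hl k(3) using ind_path_adj[OF path] by blast+
          then have "k = 1" "Suc k = length ps - 1" using k(2) by linarith+
          then show False using n4 by simp
        qed
        ultimately show "x \<in> A" using xp ps W by auto
      qed
      ultimately have "odd (length ps)" using bal path ends unfolding balanced_pair_def by blast
      then show False using ev by simp
    qed
  qed
  moreover have "even (length vs)" if h0: "hole (insert z W) (co F) vs" for vs
  proof (cases "z \<in> set vs")
    case False
    have vs: "set vs \<subseteq> W" using that False by (auto simp: hole_def)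
    have "hole V (co E) vs"
      by (rule hole_cong[OF that]) (use vs W(2) coFW in blast)+
    then show ?thesis using no_odd_antihole by blast
  next
    case True
    then obtain ps where h: "hole (insert z W) (co F) (z # ps)" and len: "length vs = Suc (length ps)"
      using hole_rotate_to[OF h0 True] by blast
    note hD = hole_ConsD[OF h]
    have ps: "set ps \<subseteq> W" "ps \<noteq> []" "distinct ps" using hD(1,2) by (auto simp: ind_path_def)
    have path: "ind_path V (co E) ps" 
      by (rule ind_path_cong[OF hD(1)]) (use ps(1) W(2) coFW in blast)+
    have hl: "hd ps = ps!0" "last ps = ps!(length ps - 1)" using ps by (simp_all add: hd_conv_nth last_conv_nth)
    have endW: "hd ps \<in> W" "last ps \<in> W" using ps(1,2) by (meson hd_in_set last_in_set subsetD)+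
    then have notB2: "hd ps \<notin> B2" "last ps \<notin> B2" using hD(4,5) coFz by simp_all
    show ?thesis
    proof (rule ccontr)
      assume "odd (length vs)"
      then have ev: "even (length ps)" using len by simp
      then have "length ps \<noteq> 3" by auto
      then have n4: "length ps \<ge> 4" using hD(3) by linarith
      have inB2: "ps!k \<in> B2" if k: "0 < k" "Suc k < length ps" for k
      proof -
        have "ps!k \<noteq> hd ps" "ps!k \<noteq> last ps" unfolding hl using k n4 ps
          by (auto simp: nth_eq_iff_index_eq)
        then show ?thesis using hD(6)[of "ps!k"] coFz[of "ps!k"] k ps by (meson Suc_lessD nth_mem subset_iff)
      qed
      \<comment> \<open>Each end is nonadjacent to the next vertex of the antipath, which lies in
        \<open>B2\<close>, whereas \<open>B1\<close> is complete to \<open>B2\<close>; so the ends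
        lie in \<open>A\<close>.\<close>
      have "co E (ps!0) (ps!1)" "co E (ps!(length ps - 1)) (ps!(length ps - 2))"
        using n4 ps(2) ind_path_adj[OF path, of 0 1]
          ind_path_adj[OF path, of "length ps - 1" "length ps - 2"] by auto
      moreover have "ps!1 \<in> B2" "ps!(length ps - 2) \<in> B2" using n4 by (auto intro!: inB2)
      ultimately have "hd ps \<notin> B1" "last ps \<notin> B1" using compl unfolding hl co_def by blast+
      then have ends: "hd ps \<in> A" "last ps \<in> A" using notB2 endW W(1) by blast+
      have "\<not> co E (hd ps) (last ps)" unfolding hl using n4 by (subst ind_path_adj[OF path]) auto
      moreover have "hd ps \<noteq> last ps" unfolding hl using n4 ps by (subst nth_eq_iff_index_eq) auto
      ultimately have "E (hd ps) (last ps)" by (simp add: co_def)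
      moreover have "set (butlast (tl ps)) \<subseteq> B2" using inB2 by (auto elim!: set_butlast_tl)
      ultimately have "odd (length ps)" using bal path ends unfolding balanced_pair_def by blast
      then show False using ev by simp
    qed
  qed
  ultimately show ?thesis unfolding berge_def antihole_def by blast
qed

text \<open>\<open>C\<close> collects the vertices whose colour is one of the \<open>b\<close>
  colours missing at the new vertex. Counting colours bounds the cliques inside \<open>C\<close> by
  \<open>b\<close> and those outside by \<open>k - b\<close>.\<close>

lemma half_split:
  assumes q: "quad V E A1 A2 B1 B2" and bal: "balanced_pair V E A1 B2"
    and k: "cliques_le E V k" and b: "cliques_le E B2 b" "K \<subseteq> B2" "clique E K" "card K = b"
  obtains C where "C \<subseteq> A1 \<union> B1 \<union> B2" "C \<inter> (B1 \<union> B2) = B2" "cliques_le E C b"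
    "cliques_le E (A1 \<union> B1 \<union> B2 - C) (k - b)"
proof -
  define W where "W = A1 \<union> B1 \<union> B2"
  have qV: "V = W \<union> A2" "A2 \<inter> W = {}" "A1 \<inter> (B1 \<union> B2) = {}" "B1 \<inter> B2 = {}"
    and compl: "\<And>x y. x \<in> B1 \<Longrightarrow> y \<in> B2 \<Longrightarrow> E x y"
    using q unfolding quad_def W_def by auto
  have "card A2 \<ge> 2" using quad_card_A quad_swap(1)[OF q] by blast
  moreover have "A2 \<noteq> {}" using calculation by auto
  ultimately obtain z where z: "z \<in> A2" by blast
  \<comment> \<open>A vertex \<open>z\<close> of \<open>A2\<close> is reused as the new vertex, so
    the graph stays on the same type; as \<open>A2\<close> has a second vertex, the new graph is
    smaller than \<open>V\<close>.\<close>
  define F where "F x y \<longleftrightarrow> x \<in> W \<and> y \<in> W \<and> E x y \<or> x = z \<and> y \<in> B2 \<or> y = z \<and> x \<in> B2" for x y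
  have zW: "z \<notin> W" using z qV by blast
  have finW: "finite W" "finite A2" using fin qV by auto
  have g: "graph (insert z W) F"
    unfolding graph_def F_def using finW zW E_sym E_irr by (auto simp: W_def)
  have FW: "F x y \<longleftrightarrow> E x y" if "x \<in> W" "y \<in> W" for x y using that zW F_def by auto
  have "berge (insert z W) F"
    by (rule berge_add_vertex[OF W_def _ zW qV(3,4) compl bal]) (use qV F_def in auto)
  moreover have "card (insert z W) < card V"
  proof -
    have "card V = card W + card A2" using qV finW by (simp add: card_Un_disjoint Int_commute)
    then show ?thesis using zW finW \<open>card A2 \<ge> 2\<close> by simp
  qed
  ultimately have hp: "hperfect (insert z W) F" using smaller_perfect[OF g] by blast
  have bk: "b \<le> k" using k b qV unfolding cliques_le_def W_def by blast
  \<comment> \<open>The weight \<open>k - b\<close> stands for that many copies of \<open>z\<close>;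
    a clique containing \<open>z\<close> otherwise lies in \<open>B2\<close>, so it still weighs at
    most \<open>k\<close>.\<close>
  define w where "w x = (if x = z then k - b else 1)" for x
  have "sum w L \<le> k" if L: "L \<subseteq> insert z W" "clique F L" for L
  proof -
    have finL: "finite L" using L finW finite_subset by blast
    have w1: "sum w (L - {z}) = card (L - {z})" unfolding w_def by simp
    have sub: "L - {z} \<subseteq> W" using L by blast
    have cl: "clique E (L - {z})" using L(2) sub FW unfolding clique_def by blast
    show ?thesis
    proof (cases "z \<in> L")
      case True
      have "L - {z} \<subseteq> B2"
      proof
        fix x assume "x \<in> L - {z}"
        then have "z \<noteq> x" "x \<in> L" by auto
        then have "F z x" using L(2) True unfolding clique_def by blast
        then show "x \<in> B2" using zW z unfolding F_def W_def by auto
      qed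
      then have "card (L - {z}) \<le> b" using b(1) cl unfolding cliques_le_def by blast
      moreover have "sum w L = (k - b) + sum w (L - {z})"
        using finL True by (subst sum.remove[of L z]) (simp_all add: w_def)
      ultimately show ?thesis using w1 bk by simp
    next
      case False
      then have "L - {z} = L" by simp
      then have "sum w L = card L" "L \<subseteq> V" "clique E L" using w1 cl sub qV by auto
      then show ?thesis using k unfolding cliques_le_def by simp
    qed
  qed
  then obtain c :: "'a \<Rightarrow> nat set" where
    c: "\<forall>x\<in>insert z W. c x \<subseteq> {..<k} \<and> card (c x) = w x"
       "\<forall>x\<in>insert z W. \<forall>y\<in>insert z W. F x y \<longrightarrow> c x \<inter> c y = {}"
    using weighted_colouring[OF _ hp graphD(3)[OF g], of w k] finW by auto
  have cz: "c z \<subseteq> {..<k}" "card (c z) = k - b" using c(1) by (auto simp: w_def)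
  define T where "T = {..<k} - c z"
  have cardT: "card T = b" unfolding T_def using cz bk by (subst card_Diff_subset) (auto intro: finite_subset)
  have finT: "finite T" by (simp add: T_def)
  have single: "card (c x) = 1" "c x \<subseteq> {..<k}" if "x \<in> W" for x using c(1) that zW by (auto simp: w_def)
  have disj: "c x \<inter> c y = {}" if "x \<in> W" "y \<in> W" "E x y" for x y using c(2) FW that by blast
  have B2T: "c x \<subseteq> T" if "x \<in> B2" for x
  proof -
    have "F z x" using that by (simp add: F_def)
    then have "c z \<inter> c x = {}" using c(2) that W_def by blast
    then show ?thesis using single(2)[of x] that unfolding T_def W_def by blast
  qed
  have card_UN: "card (\<Union>x\<in>L. c x) = card L" if "L \<subseteq> W" "clique E L" for L
  proof -
    have "card (\<Union>x\<in>L. c x) = (\<Sum>x\<in>L. card (c x))"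
    proof (rule card_UN_disjoint)
      show "finite L" using that finW finite_subset by blast
      show "\<forall>i\<in>L. finite (c i)" using single(2) that finite_subset[OF _ finite_lessThan] by blast
      show "\<forall>i\<in>L. \<forall>j\<in>L. i \<noteq> j \<longrightarrow> c i \<inter> c j = {}"
        using disj that unfolding clique_def by blast
    qed
    also have "\<dots> = card L" using single(1) that by (simp add: subset_iff)
    finally show ?thesis .
  qed
  \<comment> \<open>The clique \<open>K\<close> has \<open>b\<close> vertices and uses only colours
    of \<open>T\<close>, so it exhausts \<open>T\<close>; vertices of \<open>B1\<close>, being
    complete to \<open>K\<close>, then avoid \<open>T\<close>.\<close>
  have KT: "(\<Union>x\<in>K. c x) = T"
  proof (rule card_subset_eq[OF finT])
    show "(\<Union>x\<in>K. c x) \<subseteq> T" using B2T b(2) by blast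
    have "K \<subseteq> W" using b(2) unfolding W_def by blast
    then show "card (\<Union>x\<in>K. c x) = card T" using card_UN b(3,4) cardT by simp
  qed
  define C where "C = {x\<in>W. c x \<subseteq> T}"
  have B1C: "x \<notin> C" if "x \<in> B1" for x
  proof
    assume "x \<in> C"
    have xW: "x \<in> W" using that by (simp add: W_def)
    have "c x \<inter> c y = {}" if y: "y \<in> K" for y
      using disj[OF xW, of y] compl[OF \<open>x \<in> B1\<close>, of y] y b(2) unfolding W_def by blast
    then have "c x \<inter> T = {}" using KT by blast
    then have "c x = {}" using \<open>x \<in> C\<close> unfolding C_def by blast
    then show False using single(1)[OF xW] by simp
  qed
  show thesis
  proof (rule that[of C])
    show "C \<subseteq> A1 \<union> B1 \<union> B2" by (auto simp: C_def W_def)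
    show "C \<inter> (B1 \<union> B2) = B2" using B1C B2T unfolding C_def W_def by blast
    show "cliques_le E C b"
      unfolding cliques_le_def
    proof (intro allI impI)
      fix L assume L: "L \<subseteq> C" "clique E L"
      then have "L \<subseteq> W" by (auto simp: C_def)
      then have "card L = card (\<Union>x\<in>L. c x)" using card_UN L(2) by simp
      also have "\<dots> \<le> card T" by (rule card_mono[OF finT]) (use L in \<open>auto simp: C_def\<close>)
      finally show "card L \<le> b" using cardT by simp
    qed
    show "cliques_le E (A1 \<union> B1 \<union> B2 - C) (k - b)"
      unfolding cliques_le_def
    proof (intro allI impI)
      fix L assume L: "L \<subseteq> A1 \<union> B1 \<union> B2 - C" "clique E L"
      then have LW: "L \<subseteq> W" by (auto simp: W_def)
      then have "card L = card (\<Union>x\<in>L. c x)" using card_UN L by auto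
      also have "\<dots> \<le> card (c z)"
      proof (rule card_mono)
        show "finite (c z)" using cz finite_subset by blast
        \<comment> \<open>Each vertex of \<open>W\<close> carries a single colour, so a vertex
          outside \<open>C\<close> has its colour outside \<open>T\<close>, that is, in
          \<open>c z\<close>.\<close>
        have "c x \<subseteq> c z" if x: "x \<in> L" for x
        proof -
          have "x \<in> W" "x \<notin> C" using x L LW by auto
          then obtain t where "t \<in> c x" "t \<notin> T" by (auto simp: C_def)
          moreover have "c x = {t}" using single(1)[OF \<open>x \<in> W\<close>] \<open>t \<in> c x\<close> by (metis card_1_singletonE singletonD)
          ultimately show ?thesis using single(2)[OF \<open>x \<in> W\<close>] by (auto simp: T_def)
        qed
        then show "(\<Union>x\<in>L. c x) \<subseteq> c z" by blast
      qed
      finally show "card L \<le> k - b" using cz by simp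
    qed
  qed
qed

text \<open>The sets obtained for the two sides agree on \<open>B1 \<union> B2\<close>. As no clique
  meets both \<open>A1\<close> and \<open>A2\<close>, their union and its complement keep the clique
  bounds \<open>b\<close> and \<open>k - b\<close>, and \<open>no_good_split\<close>
  applies.\<close>

theorem no_balanced_quad:
  assumes q: "quad V E A1 A2 B1 B2" and bal: "balanced_pair V E A1 B2" "balanced_pair V E A2 B2"
  shows False
proof -
  obtain k where k: "cliques_le E V k" "\<not> colourable E V k" using not_colourable .
  let ?S = "card ` {K. K \<subseteq> B2 \<and> clique E K}"
  have finB2: "finite B2" using fin q unfolding quad_def by auto
  then have "finite ?S" by simp
  moreover have "?S \<noteq> {}" by (auto simp: clique_def)
  ultimately have "Max ?S \<in> ?S" "\<forall>n\<in>?S. n \<le> Max ?S" by (simp_all only: Max_in Max_ge ball_simps, auto)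
  then obtain K where K: "K \<subseteq> B2" "clique E K" "\<And>L. L \<subseteq> B2 \<Longrightarrow> clique E L \<Longrightarrow> card L \<le> card K" by auto
  define b where "b = card K"
  have b: "cliques_le E B2 b" using K(3) unfolding cliques_le_def b_def by blast
  obtain C1 where C1: "C1 \<subseteq> A1 \<union> B1 \<union> B2" "C1 \<inter> (B1 \<union> B2) = B2" "cliques_le E C1 b"
    "cliques_le E (A1 \<union> B1 \<union> B2 - C1) (k - b)"
    using half_split[OF q bal(1) k(1) b K(1,2) b_def[symmetric]] .
  obtain C2 where C2: "C2 \<subseteq> A2 \<union> B1 \<union> B2" "C2 \<inter> (B1 \<union> B2) = B2" "cliques_le E C2 b"
    "cliques_le E (A2 \<union> B1 \<union> B2 - C2) (k - b)"
    using half_split[OF quad_swap(1)[OF q] bal(2) k(1) b K(1,2) b_def[symmetric]] .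
  have V: "V = A1 \<union> A2 \<union> B1 \<union> B2" and disj: "A1 \<inter> A2 = {}" "B1 \<inter> B2 = {}" "(A1 \<union> A2) \<inter> (B1 \<union> B2) = {}"
    and ne: "B1 \<noteq> {}" "B2 \<noteq> {}" and anti: "\<forall>x\<in>A1. \<forall>y\<in>A2. \<not> E x y"
    using q unfolding quad_def by blast+
  have side: "L \<inter> A1 = {} \<or> L \<inter> A2 = {}" if "clique E L" for L
  proof (rule ccontr)
    assume "\<not> ?thesis"
    then obtain x y where xy: "x \<in> L" "x \<in> A1" "y \<in> L" "y \<in> A2" by blast
    then have "x \<noteq> y" using disj(1) by blast
    then have "E x y" using that xy(1,3) by (simp add: clique_def)
    then show False using anti xy by blast
  qed
  let ?C = "C1 \<union> C2"
  show False
  proof (rule no_good_split[OF k, of ?C b])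
    show "?C \<noteq> {}" using C1(2) ne by blast
    have "?C \<inter> B1 = {}" using C1(2) C2(2) disj(2) by blast
    moreover have "?C \<subseteq> V" using C1(1) C2(1) V by blast
    moreover obtain x where "x \<in> B1" using ne by blast
    ultimately show "?C \<subset> V" using V by blast
    show "b \<le> k" using k(1) K(1,2) V unfolding cliques_le_def b_def by blast
    show "cliques_le E ?C b"
      unfolding cliques_le_def
    proof (intro allI impI)
      fix L assume L: "L \<subseteq> ?C" "clique E L"
      \<comment> \<open>Both sets meet \<open>B1 \<union> B2\<close> exactly in \<open>B2\<close>,
        so a clique of the union that misses \<open>A1\<close> lies in \<open>C2\<close>, and one
        that misses \<open>A2\<close> lies in \<open>C1\<close>.\<close>
      have "L \<subseteq> C1 \<or> L \<subseteq> C2"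
        using side[OF L(2)]
      proof
        assume e: "L \<inter> A1 = {}"
        have "x \<in> C2" if "x \<in> L" for x
        proof (cases "x \<in> C2")
          case False
          then have "x \<in> C1" using L(1) that by blast
          then have "x \<in> B1 \<union> B2" using C1(1) e that by blast
          then have "x \<in> B2" using C1(2) \<open>x \<in> C1\<close> by blast
          then show ?thesis using C2(2) by blast
        qed
        then show ?thesis by blast
      next
        assume e: "L \<inter> A2 = {}"
        have "x \<in> C1" if "x \<in> L" for x
        proof (cases "x \<in> C1")
          case False
          then have "x \<in> C2" using L(1) that by blast
          then have "x \<in> B1 \<union> B2" using C2(1) e that by blast
          then have "x \<in> B2" using C2(2) \<open>x \<in> C2\<close> by blast
          then show ?thesis using C1(2) by blast
        qed
        then show ?thesis by blast
      qed
      then show "card L \<le> b" using C1(3) C2(3) L(2) unfolding cliques_le_def by blast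
    qed
    show "cliques_le E (V - ?C) (k - b)"
      unfolding cliques_le_def
    proof (intro allI impI)
      fix L assume L: "L \<subseteq> V - ?C" "clique E L"
      have "L \<subseteq> A1 \<union> B1 \<union> B2 - C1 \<or> L \<subseteq> A2 \<union> B1 \<union> B2 - C2"
        using side[OF L(2)] L(1) V by blast
      then show "card L \<le> k - b" using C1(4) C2(4) L(2) unfolding cliques_le_def by blast
    qed
  qed
qed

end

section \<open>Loose skew partitions\<close>

lemma component_no_edges:
  assumes "symp R" "component R A C" "c \<in> C" "a \<in> A - C"
  shows "\<not> R c a"
proof
  assume "R c a"
  then have "connected_in R (insert a C)"
    using connected_in_insert[OF assms(1) _ assms(3)] assms(2) by (simp add: component_def)
  moreover have "insert a C \<subseteq> A" using assms(2,4) by (auto simp: component_def)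
  ultimately have "insert a C = C" using assms(2) unfolding component_def by (metis subset_insertI)
  then show False using assms(4) by auto
qed

text \<open>Traversing \<open>R\<close> forwards and \<open>S\<close> backwards gives a cycle on
  \<open>length R + length S + 2\<close> vertices. This combines a path through one side of a split
  with a path through the other.\<close>

lemma hole_of_two_paths:
  assumes "symp E" "irreflp E" "ind_path V E (x # R @ [y])" "ind_path V E (x # S @ [y])"
    and "R \<noteq> []" "S \<noteq> []" "set R \<inter> set S = {}" and no: "\<And>r s. r \<in> set R \<Longrightarrow> s \<in> set S \<Longrightarrow> \<not> E r s"
  shows "hole V E (x # R @ [y] @ rev S)"
proof -
  have yS: "ind_path V E (y # rev S @ [x])" using ind_path_rev[OF assms(4)] by simp
  have d: "x \<notin> set R" "x \<noteq> y" "x \<notin> set S" "y \<notin> set S" "x \<in> V"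
    using assms(3,4) by (auto simp: ind_path_def)
  obtain r R' where R: "R = r # R'" using assms(5) by (cases R) auto
  obtain s S' where S: "S = s # S'" using assms(6) by (cases S) auto
  obtain T t where T: "S = T @ [t]" using assms(6) by (cases S rule: rev_cases) auto
  have p1: "ind_path V E (R @ [y])"
    using ind_path_sub[of V E "[x]" "R @ [y]" "[]"] assms(3) by simp
  have p2: "ind_path V E (rev S)"
    by (rule ind_path_rev) (use ind_path_sub[of V E "[x]" S "[y]"] assms(4,6) in simp)
  have yt: "E y t" using ind_path_adj[OF yS, of 0 1] by (simp add: T)
  have p: "ind_path V E ((R @ [y]) @ rev S)"
  proof (rule ind_path_appendI[OF assms(1) p1 p2])
    show "set (R @ [y]) \<inter> set (rev S) = {}" using assms(7) d by auto
    show "E (last (R @ [y])) (hd (rev S))" using yt by (simp add: T)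
    fix u w assume uw: "u \<in> set (R @ [y])" "w \<in> set (rev S)" "E u w"
    then have "u = y" using no[of u w] by auto
    then have "w = t" using ind_path_ConsD[OF yS, of w] uw by (auto simp: T)
    then show "u = last (R @ [y]) \<and> w = hd (rev S)" using \<open>u = y\<close> by (simp add: T)
  qed
  have xr: "E x r" using ind_path_adj[OF assms(3), of 0 1] by (simp add: R)
  have xs: "E x s" using ind_path_adj[OF assms(4), of 0 1] by (simp add: S)
  have "hole V E (x # (R @ [y]) @ rev S)"
  proof (rule hole_ConsI[OF assms(1,2) p])
    fix q assume q: "q \<in> set ((R @ [y]) @ rev S)" "E x q"
    then consider "q \<in> set (R @ [y])" | "q \<in> set (S @ [y])" by auto
    then show "q = hd ((R @ [y]) @ rev S) \<or> q = last ((R @ [y]) @ rev S)"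
    proof cases
      case 1
      then show ?thesis using ind_path_ConsD[OF assms(3), of q] q(2) by (simp add: R)
    next
      case 2
      then show ?thesis using ind_path_ConsD[OF assms(4), of q] q(2) by (simp add: S)
    qed
  qed (use d xr xs in \<open>auto simp: R S\<close>)
  then show ?thesis by simp
qed

context min_imperfect
begin

text \<open>The vertex \<open>v\<close> is adjacent to all of \<open>B2\<close> and to none of
  \<open>A1\<close>, so it completes a forbidden path to an odd hole and a forbidden antipath to an
  odd antihole.\<close>

lemma balanced_pair_loose_component:
  assumes q: "quad V E A1 A2 B1 B2" and v: "v \<in> B1" "\<forall>c\<in>A1. \<not> E v c"
  shows "balanced_pair V E A1 B2"
proof -
  have V: "v \<in> V" "A1 \<subseteq> V" "B2 \<subseteq> V" and vn: "v \<notin> A1" "v \<notin> B2" and vB: "\<And>y. y \<in> B2 \<Longrightarrow> E v y"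
    using q v unfolding quad_def by blast+
  show ?thesis
    unfolding balanced_pair_def
  proof (intro conjI allI impI; elim conjE; rule ccontr)
    fix vs assume vs: "ind_path V E vs" "hd vs \<in> B2" "last vs \<in> B2" "\<not> E (hd vs) (last vs)"
      "set (butlast (tl vs)) \<subseteq> A1" "\<not> odd (length vs)"
    have "v \<notin> set vs" using set_path_cases[of v vs] vs vn by blast
    then have "hole V E (v # vs)"
      using vs vB v(2) V by (intro hole_of_even_path[OF sym irr]) auto
    then show False using no_odd_hole[of "v # vs"] vs(6) by simp
  next
    fix vs assume vs: "ind_path V (co E) vs" "hd vs \<in> A1" "last vs \<in> A1" "E (hd vs) (last vs)"
      "set (butlast (tl vs)) \<subseteq> B2" "\<not> odd (length vs)"
    have nv: "v \<notin> set vs" using set_path_cases[of v vs] vs vn by blast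
    have "co E v c" if "c \<in> A1" for c using that v(2) vn by (auto simp: co_def)
    moreover have "\<not> co E v y" if "y \<in> B2" for y using that vB by (auto simp: co_def)
    ultimately have "hole V (co E) (v # vs)"
      using vs V nv by (intro hole_of_even_path[OF symp_co[OF sym] irreflp_co]) (auto simp: co_def)
    then show False using no_odd_antihole[of "v # vs"] vs(6) by simp
  qed
qed

text \<open>A forbidden path through \<open>A2\<close> shares its ends with a path through
  \<open>A1\<close> of known parity, and the two form an odd hole. A forbidden antipath with ends in
  \<open>A2\<close> contradicts \<open>gap_ok_anticonnected\<close> in the complement.\<close>

lemma balanced_pair_other_component:
  assumes q: "quad V E A1 A2 B1 B2" and conn: "connected_in E A1" and v: "v \<in> B1" "\<forall>c\<in>A1. \<not> E v c"
    and nb: "\<And>b. b \<in> B2 \<Longrightarrow> \<exists>c\<in>A1. E b c"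
  shows "balanced_pair V E A2 B2"
proof -
  have V: "A1 \<subseteq> V" "B2 \<subseteq> V" and disj: "A1 \<inter> A2 = {}" "A1 \<inter> B2 = {}" "A2 \<inter> B2 = {}" and ne: "A1 \<noteq> {}"
    and anti: "\<And>x y. x \<in> A1 \<Longrightarrow> y \<in> A2 \<Longrightarrow> \<not> E x y \<and> \<not> E y x"
    using q unfolding quad_def by auto
  note bal1 = balanced_pair_loose_component[OF q v, unfolded balanced_pair_def]
  show ?thesis
    unfolding balanced_pair_def
  proof (intro conjI allI impI; elim conjE; rule ccontr)
    fix vs assume vs: "ind_path V E vs" "hd vs \<in> B2" "last vs \<in> B2" "\<not> E (hd vs) (last vs)"
      "set (butlast (tl vs)) \<subseteq> A2" "\<not> odd (length vs)"
    let ?x = "hd vs" and ?y = "last vs"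
    have xy: "?x \<noteq> ?y" using ind_path_even_length(2)[OF vs(1) _ vs(4)] vs(6) by simp
    obtain R where R: "vs = ?x # R @ [?y]" "R \<noteq> []" by (rule ind_path_split_ends[OF vs(1) xy vs(4)])
    have RA: "set R \<subseteq> A2" using vs(5) by (subst (asm) R(1)) simp
    obtain c d where cd: "c \<in> A1" "E c ?x" "d \<in> A1" "E d ?y" using nb vs(2,3) E_sym by meson
    \<comment> \<open>Both ends have neighbours in the connected set \<open>A1\<close>, so an
      induced path through \<open>A1\<close> joins them.\<close>
    let ?D = "insert ?y (insert ?x A1)"
    have "connected_in E ?D"
      using connected_in_insert[OF sym connected_in_insert[OF sym conn cd(1,2)] _ cd(4)] cd(3) by simp
    then obtain Q where Q: "ind_path ?D E Q" "hd Q = ?x" "last Q = ?y"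
      using connected_in_path[OF sym irr] by (metis insertI1 insertI2)
    have QV: "ind_path V E Q" using ind_path_mono[OF Q(1)] V vs(2,3) by blast
    obtain S where S: "Q = ?x # S @ [?y]" "S \<noteq> []"
      using ind_path_split_ends[OF QV] Q(2,3) xy vs(4) by metis
    have SA: "set S \<subseteq> A1" using Q(1) unfolding S(1) ind_path_def by auto
    have oddQ: "odd (length Q)"
      using bal1 QV Q(2,3) vs(2-4) SA S(1) by (metis butlast_snoc list.sel(3))
    have "hole V E (?x # R @ [?y] @ rev S)"
    proof (rule hole_of_two_paths[OF sym irr])
      show "ind_path V E (?x # R @ [?y])" using vs(1) by (subst (asm) R(1))
      show "ind_path V E (?x # S @ [?y])" using QV by (simp only: S(1))
      show "set R \<inter> set S = {}" using RA SA disj(1) by blast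
      show "\<not> E r s" if "r \<in> set R" "s \<in> set S" for r s using that RA SA anti by blast
    qed (use R S in blast)+
    then have "even (length (?x # R @ [?y] @ rev S))" by (rule no_odd_hole)
    moreover have "length vs = length R + 2" by (subst R(1)) simp
    moreover have "length Q = length S + 2" by (simp add: S(1))
    ultimately show False using oddQ vs(6) by simp
  next
    fix vs assume vs: "ind_path V (co E) vs" "hd vs \<in> A2" "last vs \<in> A2" "E (hd vs) (last vs)"
      "set (butlast (tl vs)) \<subseteq> B2" "\<not> odd (length vs)"
    have cc: "co (co E) = E" by (rule co_co[OF irr])
    have n4: "length vs \<ge> 4"
      using ind_path_even_length(1)[OF vs(1)] vs(4,6) by (simp add: co_def)
    have vsV: "set vs \<inter> A1 = {}" using set_path_cases[of _ vs] vs(2,3,5) disj by blast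
    have inB: "vs!i \<in> B2" if i: "0 < i" "Suc i < length vs" for i
    proof -
      have "vs!i = butlast (tl vs) ! (i - 1)" "i - 1 < length (butlast (tl vs))"
        using i by (simp_all add: nth_butlast nth_tl)
      then show ?thesis using vs(5) nth_mem by (metis subsetD)
    qed
    \<comment> \<open>In the complement the antipath becomes the path and \<open>A1\<close> the
      anticonnected set. Both exclusions come from \<open>bal1\<close>, whose two halves exchange
      roles.\<close>
    interpret P: path_and_set V "co E" vs A1 B2
    proof
      show "symp (co E)" "irreflp (co E)" using symp_co[OF sym] irreflp_co by blast+
      show "berge V (co E)" using berge unfolding berge_def antihole_def cc by blast
      show "finite A1" using V(1) fin finite_subset by blast
      show "odd (length ws)" if w: "ind_path V (co E) ws" "hd ws \<in> A1" "last ws \<in> A1" "\<not> co E (hd ws) (last ws)"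
        "set (butlast (tl ws)) \<subseteq> B2" for ws
      proof (rule ccontr)
        assume "\<not> odd (length ws)"
        moreover from this have "hd ws \<noteq> last ws" using ind_path_even_length(2)[OF w(1) _ w(4)] by simp
        ultimately show False using bal1 w by (simp add: co_def)
      qed
      show "odd (length ws)" if w: "ind_path V (co (co E)) ws" "hd ws \<in> B2" "last ws \<in> B2" "co E (hd ws) (last ws)"
        "set (butlast (tl ws)) \<subseteq> A1" for ws
        using bal1 w unfolding cc by (simp add: co_def)
    qed (use vs(1) V vsV inB in auto)
    have gap: "P.gap_ok A1" using P.gap_ok_anticonnected[of A1] conn ne unfolding cc by blast
    have cplt: "P.cplt A1 0" "P.cplt A1 (length vs - 1)"
    proof -
      have "co E c (hd vs)" "co E c (last vs)" if "c \<in> A1" for c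
        using that vs(2,3) anti disj by (auto simp: co_def)
      moreover have "hd vs = vs!0" "last vs = vs!(length vs - 1)"
        using n4 hd_conv_nth[of vs] last_conv_nth[of vs] by fastforce+
      ultimately show "P.cplt A1 0" "P.cplt A1 (length vs - 1)" by (simp_all add: P.cplt_def)
    qed
    \<comment> \<open>Inner vertices lie in \<open>B2\<close> and have neighbours in
      \<open>A1\<close>, while the ends have none: in the complement the whole path is a single gap
      of odd length at least 3.\<close>
    have ncplt: "\<not> P.cplt A1 k" if k: "0 < k" "k < length vs - 1" for k
    proof -
      have "vs!k \<in> B2" using inB[of k] k by linarith
      then obtain c where "c \<in> A1" "E c (vs!k)" using nb E_sym by blast
      then show ?thesis unfolding P.cplt_def co_def by blast
    qed
    have "odd (length vs - 1 - 0)" "0 < length vs - 1" "length vs - 1 < length vs"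
      using vs(6) n4 by presburger+
    then have "length vs - 1 = Suc 0" using P.gap_okD[OF gap _ _ cplt ncplt] by blast
    then show False using n4 by simp
  qed
qed

text \<open>The component \<open>C\<close> is one side of the split and \<open>v\<close> lies in
  \<open>B1\<close>. Vertices of \<open>B2\<close> without neighbours in \<open>C\<close> move to
  the opposite side, after which \<open>balanced_pair_other_component\<close> applies.\<close>

lemma no_loose_vertex:
  assumes sp: "skew_partition V E A B" and b: "v \<in> B" and C: "component E A C" "\<forall>c\<in>C. \<not> E v c"
  shows False
proof -
  have AB: "A \<union> B = V" "A \<inter> B = {}" "\<not> connected_in E A" "\<not> connected_in (co E) B"
    using sp unfolding skew_partition_def anticonnected_in_def by blast+
  have C': "C \<noteq> {}" "C \<subseteq> A" "connected_in E C" using C(1) by (auto simp: component_def)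
  obtain P Q where PQ: "P \<union> Q = B" "P \<inter> Q = {}" "P \<noteq> {}" "Q \<noteq> {}" "\<And>p q. p \<in> P \<Longrightarrow> q \<in> Q \<Longrightarrow> \<not> co E p q"
    using not_connected_split[OF symp_co[OF sym] AB(4)] by metis
  have PQE: "E p q" if "p \<in> P" "q \<in> Q" for p q using PQ(2,5) that unfolding co_def by blast
  obtain B1 B2 where B: "B1 \<union> B2 = B" "B1 \<inter> B2 = {}" "B2 \<noteq> {}" "v \<in> B1"
      "\<And>p q. p \<in> B1 \<Longrightarrow> q \<in> B2 \<Longrightarrow> E p q"
  proof (cases "v \<in> P")
    case True
    then show thesis using that[of P Q] PQ PQE by blast
  next
    case False
    then show thesis using that[of Q P] PQ PQE E_sym b by blast
  qed
  have "C \<noteq> A" using C'(3) AB(3) by blast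
  then have ne: "A - C \<noteq> {}" using C' by blast
  have anti: "\<not> E x y \<and> \<not> E y x" if "x \<in> C" "y \<in> A - C" for x y
    using component_no_edges[OF sym C(1) that] E_sym by blast
  let ?N = "{b\<in>B2. \<exists>c\<in>C. E b c}"
  have quadI: "quad V E C (A - C \<union> (B2 - B')) B1 B'"
    if B': "B' \<subseteq> B2" "B' \<noteq> {}" "\<And>b. b \<in> B2 - B' \<Longrightarrow> \<forall>c\<in>C. \<not> E b c" for B'
    unfolding quad_def
  proof (intro conjI ballI)
    show "V = C \<union> (A - C \<union> (B2 - B')) \<union> B1 \<union> B'" using AB(1) B(1) B'(1) C'(2) by blast
    show "C \<inter> (A - C \<union> (B2 - B')) = {}" "(C \<union> (A - C \<union> (B2 - B'))) \<inter> (B1 \<union> B') = {}"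
      using AB(2) B(1,2) B'(1) C'(2) by blast+
    show "B1 \<inter> B' = {}" using B(2) B'(1) by blast
    show "\<not> E x y" "\<not> E y x" if "x \<in> C" "y \<in> A - C \<union> (B2 - B')" for x y
      using that anti B'(3) E_sym by blast+
    show "E x y" "E y x" if "x \<in> B1" "y \<in> B'" for x y using B(5) B'(1) that E_sym by blast+
  qed (use C' ne B B' in blast)+
  show False
  proof (cases "?N = {}")
    case True
    \<comment> \<open>If every vertex of \<open>B2\<close> could move, one vertex \<open>b0\<close>
      is left behind, and a part with a single vertex contradicts
      \<open>quad_card_B\<close>.\<close>
    obtain b0 where "b0 \<in> B2" using B(3) by blast
    then have "quad V E C (A - C \<union> (B2 - {b0})) B1 {b0}" using True by (intro quadI) blast+
    then have "quad V E C (A - C \<union> (B2 - {b0})) {b0} B1" by (rule quad_swap)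
    then have "card {b0} \<ge> 2" by (rule quad_card_B[OF mi])
    then show False by simp
  next
    case False
    have q: "quad V E C (A - C \<union> (B2 - ?N)) B1 ?N" using False by (intro quadI) blast+
    have "balanced_pair V E C ?N"
      by (rule balanced_pair_loose_component[OF q B(4) C(2)])
    moreover have "balanced_pair V E (A - C \<union> (B2 - ?N)) ?N"
      by (rule balanced_pair_other_component[OF q C'(3) B(4) C(2)]) blast
    ultimately show False using no_balanced_quad[OF q] by blast
  qed
qed

section \<open>Balanced skew partitions and complementation\<close>

lemma no_balanced_skew_partition:
  assumes "skew_partition V E A B" "balanced V E A B"
  shows False
proof -
  have AB: "A \<union> B = V" "A \<inter> B = {}" "\<not> connected_in E A" "\<not> connected_in (co E) B"
    using assms(1) unfolding skew_partition_def anticonnected_in_def by blast+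
  obtain A1 A2 where A: "A1 \<union> A2 = A" "A1 \<inter> A2 = {}" "A1 \<noteq> {}" "A2 \<noteq> {}" "\<And>p q. p \<in> A1 \<Longrightarrow> q \<in> A2 \<Longrightarrow> \<not> E p q"
    using not_connected_split[OF sym AB(3)] by metis
  obtain B1 B2 where B: "B1 \<union> B2 = B" "B1 \<inter> B2 = {}" "B1 \<noteq> {}" "B2 \<noteq> {}" "\<And>p q. p \<in> B1 \<Longrightarrow> q \<in> B2 \<Longrightarrow> \<not> co E p q"
    using not_connected_split[OF symp_co[OF sym] AB(4)] by metis
  have BE: "E p q" if "p \<in> B1" "q \<in> B2" for p q using B(2,5) that unfolding co_def by blast
  have "quad V E A1 A2 B1 B2"
    unfolding quad_def
  proof (intro conjI ballI)
    show "V = A1 \<union> A2 \<union> B1 \<union> B2" using AB(1) A(1) B(1) by blast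
    show "(A1 \<union> A2) \<inter> (B1 \<union> B2) = {}" using AB(2) A(1) B(1) by blast
    show "\<not> E x y" "\<not> E y x" if "x \<in> A1" "y \<in> A2" for x y using A(5)[OF that] E_sym by blast+
    show "E x y" "E y x" if "x \<in> B1" "y \<in> B2" for x y using BE[OF that] E_sym by blast+
  qed (use A B in blast)+
  moreover have "balanced_pair V E A1 B2" "balanced_pair V E A2 B2"
    by (rule balanced_pair_mono[OF balanced_imp_pair[OF assms(2)]]; use A(1) B(1) in blast)+
  ultimately show False by (rule no_balanced_quad)
qed

lemma no_loose_skew_partition:
  assumes sp: "skew_partition V E A B"
  shows "\<not> loose V E A B"
proof
  assume "loose V E A B"
  then consider v C where "v \<in> B" "component E A C" "\<forall>c\<in>C. \<not> E v c"
    | a D where "a \<in> A" "component (co E) B D" "\<forall>d\<in>D. E a d"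
    unfolding loose_def anticomponent_def by blast
  then show False
  proof cases
    case 1
    then show False using no_loose_vertex[OF sp] by blast
  next
    case 2
    \<comment> \<open>The second kind of looseness is the first kind in the complement, where the
      partition becomes \<open>(B, A)\<close>. Since \<open>co_on V E\<close> and
      \<open>co E\<close> agree inside \<open>V\<close>, connectivity carries over.\<close>
    interpret C: min_imperfect V "co_on V E"
      by unfold_locales (rule minimum_imperfect_co_on[OF mi])
    have AB: "A \<union> B = V" "A \<inter> B = {}" "\<not> connected_in E A" "\<not> connected_in (co E) B"
      using sp unfolding skew_partition_def anticonnected_in_def by blast+
    have con: "connected_in (co_on V E) X \<longleftrightarrow> connected_in (co E) X" if "X \<subseteq> V" for X
      by (rule connected_in_cong) (use that in \<open>auto simp: co_on_def\<close>)
    have con2: "connected_in (co (co_on V E)) A \<longleftrightarrow> connected_in E A"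
      by (rule connected_in_cong) (use AB E_irr in \<open>auto simp: co_on_def co_def\<close>)
    have "skew_partition V (co_on V E) B A"
      using AB con[of B] con2 unfolding skew_partition_def anticonnected_in_def by blast
    moreover have "component (co_on V E) B D"
      using 2(2) con AB(1) unfolding component_def by (metis Un_upper2 subset_trans)
    moreover have "\<forall>d\<in>D. \<not> co_on V E a d" using 2(3) by (auto simp: co_on_def co_def)
    ultimately show False using C.no_loose_vertex 2(1) by blast
  qed
qed

end

theorem theorem4p9:
  fixes V :: "'a set" and E :: "'a \<Rightarrow> 'a \<Rightarrow> bool"
  assumes "minimum_imperfect V E"
  shows "(\<nexists>A B. skew_partition V E A B \<and> balanced V E A B) \<and>
         (\<forall>A B. skew_partition V E A B \<longrightarrow> \<not> loose V E A B)"
proof -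
  interpret min_imperfect V E by unfold_locales (rule assms)
  show ?thesis using no_balanced_skew_partition no_loose_skew_partition by blast
qed

end
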